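(* Let $l\geq 1$ be an integer and let $G$ be a finite simple graph with vertex connectivity $\kappa(G)\geq l+2$. If the sun toughness of $G$ satisfies $s(G)>\frac{l+1}{3}$, then $G$ is a $(P_{\geq 3},l)$-factor critical graph.
   Context: All graphs are finite and simple. $\kappa(G)$ denotes the vertex connectivity of $G$ (with $\kappa(K_n)=n-1$). A $P_{\geq k}$-factor of a graph $G$ (for an integer $k\geq 2$) is a spanning subgraph of $G$ each of whose components is isomorphic to a path of order (number of vertices) at least $k$. A graph $G$ is a $(P_{\geq k},l)$-factor critical graph if $G-V'$ contains a $P_{\geq k}$-factor for every $V'\subseteq V(G)$ with $|V'|=l$, where $G-V'$ is the subgraph induced by $V(G)\setminus V'$. A graph $H$ is factor-critical if $H-v$ has a 1-factor (perfect matching) for each $v\in V(H)$. Given a factor-critical graph $H$ with $V(H)=\{v_1,\dots,v_n\}$, the graph obtained from $H$ by adding new vertices $u_1,\dots,u_n$ together with the new edges $v_iu_i$ ($1\leq i\leq n$) is called a sun. The graphs $K_1$ and $K_2$ are also regarded as suns. A sun component of a graph $G$ is a connected component of $G$ that is isomorphic to a sun, and $sun(G)$ denotes the number of sun components of $G$. The sun toughness $s(G)$ of a connected graph $G$ is defined by $s(G)=+\infty$ if $G$ is complete, and otherwise $$s(G)=\min\left\{\frac{|X|}{sun(G-X)}: X\subseteq V(G),\ sun(G-X)\geq 2\right\}.$$ *)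

theory Defs
  imports "Graph_Theory.Graph_Theory" "HOL-Library.Extended_Real"
begin

text \<open>
  Finite simple graphs are the library's \<^locale>\<open>graph\<close>s, that is, finite, loop-free, symmetric
  digraphs without parallel arcs: an edge is a pair of opposite arcs. In such a graph
  the members of \<^const>\<open>pre_digraph.sccs\<close> are exactly the connected components, each one
  given as a (nonempty) induced subgraph.
\<close>

definition is_complete :: "('a,'b) pre_digraph \<Rightarrow> bool" where
  "is_complete G \<longleftrightarrow> complete_digraph (card (verts G)) G"

definition del_verts :: "('a,'b) pre_digraph \<Rightarrow> 'a set \<Rightarrow> ('a,'b) pre_digraph" where
  "del_verts G X = G \<restriction> (verts G - X)"

text \<open>
  A graph that is not complete has two nonadjacent vertices; deleting all the others
  disconnects it, so the minimum is over a nonempty set. The null graph, which the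
  library does not count as connected, is kept out by the strict inclusion.
\<close>

definition vertex_connectivity :: "('a,'b) pre_digraph \<Rightarrow> nat" where
  "vertex_connectivity G =
    (if is_complete G then card (verts G) - 1
     else Min (card ` {X. X \<subset> verts G \<and> \<not> connected (del_verts G X)}))"

definition path_graph :: "nat \<Rightarrow> nat pair_pre_digraph" where
  "path_graph n = \<lparr> pverts = {..<n},
    parcs = {(i, j). i < n \<and> j < n \<and> (j = Suc i \<or> i = Suc j)} \<rparr>"

definition path_factor :: "nat \<Rightarrow> ('a,'b) pre_digraph \<Rightarrow> ('a,'b) pre_digraph \<Rightarrow> bool" where
  "path_factor k F G \<longleftrightarrow> graph F \<and> spanning F G \<and>
    (\<forall>C \<in> pre_digraph.sccs F. \<exists>n\<ge>k. digraph_iso (with_proj (path_graph n)) C)"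

definition path_factor_critical :: "nat \<Rightarrow> nat \<Rightarrow> ('a,'b) pre_digraph \<Rightarrow> bool" where
  "path_factor_critical k l G \<longleftrightarrow>
    (\<forall>X. X \<subseteq> verts G \<and> card X = l \<longrightarrow> (\<exists>F. path_factor k F (del_verts G X)))"

definition perfect_matching :: "('a,'b) pre_digraph \<Rightarrow> ('a,'b) pre_digraph \<Rightarrow> bool" where
  "perfect_matching M G \<longleftrightarrow> graph M \<and> spanning M G \<and> (\<forall>v \<in> verts M. out_degree M v = 1)"

definition factor_critical :: "('a,'b) pre_digraph \<Rightarrow> bool" where
  "factor_critical H \<longleftrightarrow> graph H \<and> (\<forall>v \<in> verts H. \<exists>M. perfect_matching M (del_verts H {v}))"

text \<open>The pendant vertex attached to \<open>Inl v\<close> is \<open>Inr v\<close>.\<close>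

definition add_pendants :: "'a pair_pre_digraph \<Rightarrow> ('a + 'a) pair_pre_digraph" where
  "add_pendants H = \<lparr> pverts = Inl ` pverts H \<union> Inr ` pverts H,
    parcs = {(Inl v, Inl w) | v w. (v, w) \<in> parcs H}
      \<union> {(Inl v, Inr v) | v. v \<in> pverts H} \<union> {(Inr v, Inl v) | v. v \<in> pverts H} \<rparr>"

text \<open>
  Suns are taken up to isomorphism. It is no restriction that \<open>H\<close> has its vertices
  in the type \<open>'a\<close>, since \<open>H\<close> is isomorphic to an induced subgraph of \<open>S\<close>.
\<close>

definition is_sun :: "('a,'b) pre_digraph \<Rightarrow> bool" where
  "is_sun S \<longleftrightarrow> complete_digraph 1 S \<or> complete_digraph 2 S \<or>
    (\<exists>H :: 'a pair_pre_digraph. factor_critical (with_proj H) \<and>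
      digraph_iso (with_proj (add_pendants H)) S)"

definition sun_count :: "('a,'b) pre_digraph \<Rightarrow> nat" where
  "sun_count G = card {C \<in> pre_digraph.sccs G. is_sun C}"

text \<open>
  Again the minimum is over a nonempty set: deleting all vertices except two nonadjacent
  ones leaves two components \<open>K\<^sub>1\<close>.
\<close>

definition sun_toughness :: "('a,'b) pre_digraph \<Rightarrow> ereal" where
  "sun_toughness G =
    (if is_complete G then \<infinity>
     else Min ((\<lambda>X. ereal (real (card X) / real (sun_count (del_verts G X)))) `
            {X. X \<subseteq> verts G \<and> 2 \<le> sun_count (del_verts G X)}))"

end

theory Submission
  imports Defs
begin

text \<open>
  The theorem reduces to Kaneko's criterion: a graph has a path factor with paths of order at least
  3 if no deletion of a vertex set \<open>X\<close> leaves more than \<open>2|X|\<close> sun components. For \<open>G - W\<close> with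
  \<open>|W| = l\<close> this holds when \<open>|X| \<le> 1\<close> because \<open>G\<close> is \<open>(l+2)\<close>-connected, and when \<open>|X| \<ge> 2\<close> because
  \<open>(l + |X|) / (2|X| + 1) \<le> (l + 1) / 3\<close>.

  Kaneko's criterion is proved for a counterexample \<open>G\<close> with fewest vertices, then fewest edges.
  A sun with a prescribed vertex \<open>v\<close> splits into a path starting at \<open>v\<close> and long paths, so a vertex
  adjacent to two disjoint suns can be covered together with them. If \<open>G - S\<close> has exactly \<open>2|S|\<close> suns for
  some nonempty \<open>S\<close>, Hall's theorem hence assigns two of them to each vertex of \<open>S\<close>, and the rest is
  covered by minimality. So all bounds for nonempty \<open>X\<close> are strict.

  Then some vertex \<open>y\<close> is neither a leaf nor adjacent to one: otherwise \<open>G\<close> is a graph \<open>H\<close> with a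
  pendant vertex at every vertex, path factors correspond to perfect matchings of \<open>H\<close>, and minimality
  applied to \<open>G\<close> without a pendant edge shows that \<open>H\<close> is factor-critical and \<open>G\<close> a sun.
  If \<open>y\<close> is a cut vertex, the parts of \<open>G - y\<close>, with or without \<open>y\<close>, are covered separately. Otherwise
  delete an edge \<open>yz\<close>. By minimality some \<open>G - yz - S\<close> has too many suns, so \<open>G - S\<close> has \<open>2|S| - 1\<close> suns
  and a further component made of two suns \<open>A\<close>, \<open>B\<close> joined by \<open>yz\<close>. A suitable subset of \<open>A\<close> serves as
  the missing \<open>2|S|\<close>-th item in Hall's theorem.
\<close>

section \<open>Components and suns of a relation restricted to a vertex set\<close>

definition no_edge :: "('a \<Rightarrow> 'a \<Rightarrow> bool) \<Rightarrow> 'a set \<Rightarrow> 'a set \<Rightarrow> bool" where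
  "no_edge E A B \<longleftrightarrow> (\<forall>a\<in>A. \<forall>b\<in>B. \<not> E a b)"

text \<open>For symmetric \<open>E\<close> this is connectedness, phrased through cuts instead of
  walks: a proof only has to exhibit a nonempty subset that no edge leaves.\<close>

definition conn_set :: "('a \<Rightarrow> 'a \<Rightarrow> bool) \<Rightarrow> 'a set \<Rightarrow> bool" where
  "conn_set E C \<longleftrightarrow> C \<noteq> {} \<and> (\<forall>B. B \<subseteq> C \<and> B \<noteq> {} \<and> no_edge E B (C - B) \<longrightarrow> B = C)"

definition comps :: "('a \<Rightarrow> 'a \<Rightarrow> bool) \<Rightarrow> 'a set \<Rightarrow> 'a set set" where
  "comps E V = {C. C \<subseteq> V \<and> conn_set E C \<and> no_edge E C (V - C)}"

text \<open>A perfect matching is an involution that follows \<open>E\<close>; irreflexivity of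
  \<open>E\<close>, as in \<open>simple_rel\<close>, rules out fixed points.\<close>

definition has_pm :: "('a \<Rightarrow> 'a \<Rightarrow> bool) \<Rightarrow> 'a set \<Rightarrow> bool" where
  "has_pm E H \<longleftrightarrow> (\<exists>m. \<forall>x\<in>H. m x \<in> H \<and> m (m x) = x \<and> E x (m x))"

definition fc_set :: "('a \<Rightarrow> 'a \<Rightarrow> bool) \<Rightarrow> 'a set \<Rightarrow> bool" where
  "fc_set E H \<longleftrightarrow> (\<forall>v\<in>H. has_pm E (H - {v}))"

text \<open>\<open>u v\<close> is the pendant vertex attached to \<open>v\<close>. For the relation of a graph, a connected corona of a
factor-critical \<open>H\<close> is a sun; \<open>K\<^sub>2\<close> is the case of a single \<open>v\<close>.\<close>

definition corona :: "('a \<Rightarrow> 'a \<Rightarrow> bool) \<Rightarrow> 'a set \<Rightarrow> 'a set \<Rightarrow> ('a \<Rightarrow> 'a) \<Rightarrow> bool" where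
  "corona E C H u \<longleftrightarrow> H \<subseteq> C \<and> inj_on u H \<and> u ` H = C - H \<and> (\<forall>v\<in>H. \<forall>x\<in>C. E (u v) x \<longleftrightarrow> x = v)"

text \<open>Connectedness and nonemptiness come from elsewhere: \<open>suns\<close> applies the
  predicate to members of \<open>comps\<close> only.\<close>

definition sun_set :: "('a \<Rightarrow> 'a \<Rightarrow> bool) \<Rightarrow> 'a set \<Rightarrow> bool" where
  "sun_set E C \<longleftrightarrow> (\<exists>x. C = {x}) \<or> (\<exists>H u. corona E C H u \<and> fc_set E H)"

definition suns :: "('a \<Rightarrow> 'a \<Rightarrow> bool) \<Rightarrow> 'a set \<Rightarrow> 'a set set" where
  "suns E V = {C \<in> comps E V. sun_set E C}"

definition sun_number :: "('a \<Rightarrow> 'a \<Rightarrow> bool) \<Rightarrow> 'a set \<Rightarrow> nat" where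
  "sun_number E V = card (suns E V)"

lemma conn_setD: "conn_set E C \<Longrightarrow> B \<subseteq> C \<Longrightarrow> B \<noteq> {} \<Longrightarrow> no_edge E B (C - B) \<Longrightarrow> B = C"
  by (auto simp: conn_set_def)

lemma conn_set_sing: "conn_set E {x}"
  by (auto simp: conn_set_def)

lemma comps_subset: "C \<in> comps E V \<Longrightarrow> C \<subseteq> V"
  by (auto simp: comps_def)

lemma comps_ne: "C \<in> comps E V \<Longrightarrow> C \<noteq> {}"
  by (auto simp: comps_def conn_set_def)

lemma comps_disj:
  assumes "C \<in> comps E V" "C' \<in> comps E V" "C \<inter> C' \<noteq> {}" shows "C = C'"
proof -
  have a: "C \<inter> C' = C"
    by (rule conn_setD[of E]) (use assms in \<open>auto simp: comps_def no_edge_def\<close>)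
  have b: "C \<inter> C' = C'"
    by (rule conn_setD[of E]) (use assms in \<open>auto simp: comps_def no_edge_def\<close>)
  show ?thesis using a b by auto
qed

lemma finite_comps: "finite V \<Longrightarrow> finite (comps E V)"
  by (rule finite_subset[of _ "Pow V"]) (auto simp: comps_def)

lemma finite_suns: "finite V \<Longrightarrow> finite (suns E V)"
  by (simp add: suns_def finite_comps)

text \<open>A connected set that meets \<open>A\<close> lies in \<open>A\<close>, since its trace on
  \<open>A\<close> is closed.\<close>

lemma comps_Un:
  assumes "no_edge E A B" "no_edge E B A"
  shows "comps E (A \<union> B) = comps E A \<union> comps E B"
proof -
  have 1: "C \<subseteq> A \<or> C \<subseteq> B" if "C \<subseteq> A \<union> B" "conn_set E C" for C
  proof (cases "C \<inter> A = {}")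
    case False
    have "C \<inter> A = C"
    proof (rule conn_setD[OF that(2)])
      show "no_edge E (C \<inter> A) (C - C \<inter> A)" using that(1) assms by (auto simp: no_edge_def)
    qed (use False in auto)
    thus ?thesis by auto
  qed (use that in auto)
  show ?thesis
  proof (intro equalityI subsetI)
    fix C assume "C \<in> comps E (A \<union> B)"
    thus "C \<in> comps E A \<union> comps E B" using 1[of C]
      by (fastforce simp: comps_def no_edge_def)
  qed (use assms in \<open>auto simp: comps_def no_edge_def\<close>)
qed

lemma sun_number_Un:
  assumes "no_edge E A B" "no_edge E B A" "A \<inter> B = {}" "finite A" "finite B"
  shows "sun_number E (A \<union> B) = sun_number E A + sun_number E B"
proof -
  have "suns E (A \<union> B) = suns E A \<union> suns E B"
    using comps_Un[OF assms(1,2)] by (auto simp: suns_def)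
  moreover have "suns E A \<inter> suns E B = {}"
  proof -
    have False if "C \<in> comps E A" "C \<in> comps E B" for C
      using assms(3) comps_subset[OF that(1)] comps_subset[OF that(2)] comps_ne[OF that(1)] by auto
    thus ?thesis by (auto simp: suns_def)
  qed
  ultimately show ?thesis unfolding sun_number_def using assms finite_suns by (metis card_Un_disjoint)
qed

lemma comps_conn: "conn_set E V \<Longrightarrow> comps E V = {V}"
  by (auto simp: comps_def conn_set_def no_edge_def)

lemma comps_empty[simp]: "comps E {} = {}"
  by (auto simp: comps_def conn_set_def)

lemma sun_number_empty[simp]: "sun_number E {} = 0"
  by (simp add: sun_number_def suns_def)

lemma sun_number_conn: "conn_set E V \<Longrightarrow> sun_number E V = (if sun_set E V then 1 else 0)"
proof -
  assume "conn_set E V"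
  hence "suns E V = (if sun_set E V then {V} else {})" by (auto simp: suns_def comps_conn)
  thus ?thesis by (simp add: sun_number_def)
qed

lemma sun_set_sing: "sun_set E {x}" by (auto simp: sun_set_def)

lemma sun_number_sing: "sun_number E {x} = 1"
  by (simp add: sun_number_conn conn_set_sing sun_set_sing)

section \<open>Dependence on the relation inside the vertex set only\<close>

lemma conn_set_cong: "(\<And>x y. x \<in> V \<Longrightarrow> y \<in> V \<Longrightarrow> E x y = E' x y) \<Longrightarrow> conn_set E V = conn_set E' V"
  unfolding conn_set_def no_edge_def by (metis DiffD1 subsetD)

lemma has_pm_cong: "(\<And>x y. x \<in> V \<Longrightarrow> y \<in> V \<Longrightarrow> E x y = E' x y) \<Longrightarrow> has_pm E V = has_pm E' V"
  unfolding has_pm_def by metis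

lemma fc_set_cong: "(\<And>x y. x \<in> V \<Longrightarrow> y \<in> V \<Longrightarrow> E x y = E' x y) \<Longrightarrow> fc_set E V = fc_set E' V"
  unfolding fc_set_def using has_pm_cong[of "V - {_}" E E'] by auto

lemma corona_cong: "(\<And>x y. x \<in> V \<Longrightarrow> y \<in> V \<Longrightarrow> E x y = E' x y) \<Longrightarrow> corona E V H u = corona E' V H u"
  unfolding corona_def by (metis DiffD1 imageI)

lemma sun_set_cong:
  assumes "\<And>x y. x \<in> V \<Longrightarrow> y \<in> V \<Longrightarrow> E x y = E' x y" shows "sun_set E V = sun_set E' V"
proof -
  have "fc_set E H = fc_set E' H" if "corona E V H u" for H u
    by (rule fc_set_cong) (use that assms in \<open>auto simp: corona_def\<close>)
  moreover have "corona E V H u = corona E' V H u" for H u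
    by (rule corona_cong) (use assms in auto)
  ultimately show ?thesis unfolding sun_set_def by blast
qed

text \<open>This carries sun counts from a graph to its induced subgraphs, and to the graph without
  an edge when the set at hand misses an end of that edge.\<close>

lemma sun_number_cong:
  assumes "\<And>x y. x \<in> V \<Longrightarrow> y \<in> V \<Longrightarrow> E x y = E' x y" shows "sun_number E V = sun_number E' V"
proof -
  have "suns E V = suns E' V"
    unfolding suns_def
  proof (rule Collect_cong)
    fix C
    have "conn_set E C = conn_set E' C \<and> no_edge E C (V - C) = no_edge E' C (V - C)" if "C \<subseteq> V"
    proof
      show "conn_set E C = conn_set E' C" by (rule conn_set_cong) (use assms that in auto)
      show "no_edge E C (V - C) = no_edge E' C (V - C)"
        unfolding no_edge_def by (intro ball_cong refl) (use assms that in auto)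
    qed
    hence "C \<in> comps E V \<longleftrightarrow> C \<in> comps E' V" unfolding comps_def by blast
    moreover have "C \<subseteq> V \<Longrightarrow> sun_set E C = sun_set E' C" by (rule sun_set_cong) (use assms in auto)
    ultimately show "C \<in> comps E V \<and> sun_set E C \<longleftrightarrow> C \<in> comps E' V \<and> sun_set E' C"
      using comps_subset by blast
  qed
  thus ?thesis by (simp add: sun_number_def)
qed

section \<open>Covers by paths of order at least 3\<close>

definition simple_path :: "('a \<Rightarrow> 'a \<Rightarrow> bool) \<Rightarrow> 'a list \<Rightarrow> bool" where
  "simple_path E p \<longleftrightarrow> distinct p \<and> successively E p"

inductive path_cover :: "('a \<Rightarrow> 'a \<Rightarrow> bool) \<Rightarrow> 'a set \<Rightarrow> bool" for E where
  path_cover_empty: "path_cover E {}"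
| path_cover_add: "path_cover E A \<Longrightarrow> simple_path E p \<Longrightarrow> 3 \<le> length p \<Longrightarrow> set p \<inter> A = {} \<Longrightarrow> path_cover E (A \<union> set p)"

text \<open>A cover under construction: the path starting at the root \<open>v\<close> may still be
  shorter than 3 and is to be prolonged at \<open>v\<close>, while the rest of \<open>C\<close> is
  already covered.\<close>

definition rooted_cover :: "('a \<Rightarrow> 'a \<Rightarrow> bool) \<Rightarrow> nat \<Rightarrow> 'a set \<Rightarrow> 'a \<Rightarrow> bool" where
  "rooted_cover E k C v \<longleftrightarrow> (\<exists>p. simple_path E p \<and> k \<le> length p \<and> p \<noteq> [] \<and> hd p = v \<and> set p \<subseteq> C \<and> path_cover E (C - set p))"

lemma path_cover_path: "simple_path E p \<Longrightarrow> 3 \<le> length p \<Longrightarrow> path_cover E (set p)"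
  using path_cover_add[OF path_cover_empty] by force

lemma path_cover_Un: "path_cover E A \<Longrightarrow> path_cover E B \<Longrightarrow> A \<inter> B = {} \<Longrightarrow> path_cover E (A \<union> B)"
proof (induction rule: path_cover.induct)
  case (path_cover_add A p)
  have "path_cover E ((A \<union> B) \<union> set p)"
    by (rule path_cover.path_cover_add) (use path_cover_add in auto)
  thus ?case by (simp add: Un_ac)
qed simp

lemma path_cover_UN:
  assumes "finite I" "\<And>i. i \<in> I \<Longrightarrow> path_cover E (F i)" "\<And>i j. i \<in> I \<Longrightarrow> j \<in> I \<Longrightarrow> i \<noteq> j \<Longrightarrow> F i \<inter> F j = {}"
  shows "path_cover E (\<Union>i\<in>I. F i)"
  using assms
proof (induction I rule: finite_induct)
  case (insert i I)
  have "F i \<inter> (\<Union>i\<in>I. F i) = {}" using insert by blast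
  thus ?case using insert path_cover_Un[of E "F i" "\<Union>i\<in>I. F i"] by simp
qed (simp add: path_cover_empty)

lemma path_cover_mono: "path_cover E A \<Longrightarrow> (\<And>x y. E x y \<Longrightarrow> E' x y) \<Longrightarrow> path_cover E' A"
proof (induction rule: path_cover.induct)
  case (path_cover_add A p)
  have "simple_path E' p" using path_cover_add by (auto simp: simple_path_def intro: successively_mono)
  thus ?case using path_cover_add path_cover.path_cover_add by metis
qed (simp add: path_cover_empty)

text \<open>The inductive form suits gluing; the explicit family of disjoint paths serves for
  analysing a given cover and for building a path factor.\<close>

lemma path_cover_set:
  assumes "path_cover E A"
  shows "\<exists>P. finite P \<and> (\<forall>p\<in>P. simple_path E p \<and> 3 \<le> length p) \<and> (\<Union>p\<in>P. set p) = A \<and>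
     (\<forall>p\<in>P. \<forall>q\<in>P. p \<noteq> q \<longrightarrow> set p \<inter> set q = {})"
  using assms
proof (induction rule: path_cover.induct)
  case path_cover_empty
  show ?case by (rule exI[of _ "{}"]) auto
next
  case (path_cover_add A p)
  then obtain P where "finite P \<and> (\<forall>p\<in>P. simple_path E p \<and> 3 \<le> length p) \<and> (\<Union>p\<in>P. set p) = A \<and>
     (\<forall>p\<in>P. \<forall>q\<in>P. p \<noteq> q \<longrightarrow> set p \<inter> set q = {})" by blast
  thus ?case using path_cover_add by (intro exI[of _ "insert p P"]) auto
qed

lemma rooted_cover_cons: "rooted_cover E k C c \<Longrightarrow> E s c \<Longrightarrow> s \<notin> C \<Longrightarrow> rooted_cover E (Suc k) (insert s C) s"
  unfolding rooted_cover_def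
proof (elim exE conjE, goal_cases)
  case (1 p)
  have "insert s C - set (s # p) = C - set p" using 1 by auto
  moreover have "simple_path E (s # p)" using 1 by (auto simp: simple_path_def successively_Cons)
  ultimately show ?case using 1 by (intro exI[of _ "s # p"]) auto
qed

lemma rooted_cover_sing: "rooted_cover E 1 {x} x"
  unfolding rooted_cover_def by (rule exI[of _ "[x]"]) (auto simp: simple_path_def path_cover_empty)

lemma rooted_cover_Un: "rooted_cover E k C c \<Longrightarrow> path_cover E R \<Longrightarrow> C \<inter> R = {} \<Longrightarrow> rooted_cover E k (C \<union> R) c"
  unfolding rooted_cover_def
proof (elim exE conjE, goal_cases)
  case (1 p)
  have "C \<union> R - set p = (C - set p) \<union> R" using 1 by auto
  moreover have "path_cover E ((C - set p) \<union> R)" using 1 by (intro path_cover_Un) auto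
  ultimately show ?case using 1 by (intro exI[of _ p]) auto
qed

lemma rooted_cover_le: "rooted_cover E k C c \<Longrightarrow> j \<le> k \<Longrightarrow> rooted_cover E j C c"
  unfolding rooted_cover_def using le_trans by blast

section \<open>Symmetric irreflexive relations: components and gluing of covers\<close>

locale simple_rel =
  fixes E :: "'a \<Rightarrow> 'a \<Rightarrow> bool"
  assumes sym: "E x y \<Longrightarrow> E y x" and irr: "\<not> E x x"
begin

lemma no_edge_sym: "no_edge E A B \<Longrightarrow> no_edge E B A"
  using sym by (auto simp: no_edge_def)

text \<open>The component is a closed set around \<open>v\<close> of least cardinality. If no edge
  joined a part \<open>B\<close> to the rest of it, then \<open>B\<close> or that rest would be a
  closed set around \<open>v\<close> too, and minimality leaves only \<open>B = C\<close>.\<close>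

lemma in_comp:
  assumes "finite V" "v \<in> V" shows "\<exists>C\<in>comps E V. v \<in> C"
proof -
  define P where "P C \<longleftrightarrow> v \<in> C \<and> C \<subseteq> V \<and> no_edge E C (V - C)" for C
  have "P V" using assms by (auto simp: P_def no_edge_def)
  then obtain C where C: "P C" and mn: "\<And>D. P D \<Longrightarrow> card C \<le> card D"
    using ex_has_least_nat[of P V card] by blast
  have fin: "finite C" using C assms by (auto simp: P_def intro: finite_subset)
  have "conn_set E C"
    unfolding conn_set_def
  proof (intro conjI allI impI)
    show "C \<noteq> {}" using C by (auto simp: P_def)
    fix B assume B: "B \<subseteq> C \<and> B \<noteq> {} \<and> no_edge E B (C - B)"
    show "B = C"
    proof (cases "v \<in> B")
      case True
      have "P B" using B C True unfolding P_def no_edge_def by blast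
      thus ?thesis using mn[of B] B fin by (metis card_seteq)
    next
      case False
      have "P (C - B)" using False B C no_edge_sym[of B "C - B"] by (auto simp: P_def no_edge_def)
      hence "C - B = C" using mn[of "C - B"] fin by (metis card_seteq Diff_subset)
      thus ?thesis using B by auto
    qed
  qed
  thus ?thesis using C by (auto simp: comps_def P_def)
qed

lemma simple_path_join:
  assumes "simple_path E p" "simple_path E q" "p \<noteq> []" "q \<noteq> []" "E (hd p) (hd q)" "set p \<inter> set q = {}"
  shows "simple_path E (rev p @ q)"
proof -
  have "successively E (rev p)"
    unfolding successively_rev by (rule successively_mono[of E]) (use assms sym in \<open>auto simp: simple_path_def\<close>)
  thus ?thesis using assms by (auto simp: simple_path_def successively_append_iff last_rev)
qed

text \<open>The two root paths are concatenated at their roots, the first one reversed;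
  \<open>3 \<le> k + j\<close> makes the resulting path long enough.\<close>

lemma rooted_cover_join:
  assumes "rooted_cover E k A a" "rooted_cover E j B b" "E a b" "A \<inter> B = {}" "3 \<le> k + j"
  shows "path_cover E (A \<union> B)"
proof -
  obtain p where p: "simple_path E p" "k \<le> length p" "p \<noteq> []" "hd p = a" "set p \<subseteq> A" "path_cover E (A - set p)"
    using assms(1) by (auto simp: rooted_cover_def)
  obtain q where q: "simple_path E q" "j \<le> length q" "q \<noteq> []" "hd q = b" "set q \<subseteq> B" "path_cover E (B - set q)"
    using assms(2) by (auto simp: rooted_cover_def)
  have "path_cover E (((A - set p) \<union> (B - set q)) \<union> set (rev p @ q))"
  proof (rule path_cover_add)
    show "path_cover E (A - set p \<union> (B - set q))" using p q assms by (intro path_cover_Un) auto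
    show "simple_path E (rev p @ q)" using p q assms by (intro simple_path_join) auto
  qed (use p q assms in auto)
  moreover have "((A - set p) \<union> (B - set q)) \<union> set (rev p @ q) = A \<union> B" using p q by auto
  ultimately show ?thesis by simp
qed

lemma has_pm_Diff2:
  assumes "\<forall>x\<in>H. m x \<in> H \<and> m (m x) = x \<and> E x (m x)" "x \<in> H"
  shows "has_pm E (H - {x, m x})"
  unfolding has_pm_def by (rule exI[of _ m]) (use assms in \<open>auto, (metis)+\<close>)

text \<open>Each matching edge \<open>x y\<close> yields the path \<open>u x, x, y, u y\<close> of
  order 4.\<close>

lemma pm_path_cover:
  assumes "finite H" "has_pm E H" "inj_on u H" "u ` H \<inter> H = {}" "\<And>v. v \<in> H \<Longrightarrow> E v (u v)"
  shows "path_cover E (H \<union> u ` H)"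
  using assms
proof (induction H rule: finite_psubset_induct)
  case (psubset H)
  show ?case
  proof (cases "H = {}")
    case False
    then obtain x where x: "x \<in> H" by auto
    obtain m where m: "\<forall>x\<in>H. m x \<in> H \<and> m (m x) = x \<and> E x (m x)" using psubset by (auto simp: has_pm_def)
    define y where "y = m x"
    have y: "y \<in> H" "E x y" using m x y_def by auto
    have ne: "x \<noteq> y" using y irr by auto
    define H' where "H' = H - {x, y}"
    have pm': "has_pm E H'" using has_pm_Diff2[OF m x] by (simp add: H'_def y_def)
    have c: "path_cover E (H' \<union> u ` H')"
    proof (rule psubset.IH)
      show "has_pm E H'" by fact
      show "inj_on u H'" using psubset by (auto simp: H'_def inj_on_def)
    qed (use x psubset in \<open>auto simp: H'_def\<close>)
    have uu: "u x \<noteq> u y" using psubset x y ne by (auto dest: inj_onD)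
    have ud: "u a \<noteq> b" if "a \<in> H" "b \<in> H" for a b using that psubset(5) by auto
    have "path_cover E ((H' \<union> u ` H') \<union> set [u x, x, y, u y])"
    proof (rule path_cover_add[OF c])
      show "simple_path E [u x, x, y, u y]" using ne uu ud x y psubset(6) sym by (auto simp: simple_path_def) (metis ud)+
      show "set [u x, x, y, u y] \<inter> (H' \<union> u ` H') = {}"
        using x y psubset(4,5) by (auto simp: H'_def dest: inj_onD)
    qed simp
    moreover have "(H' \<union> u ` H') \<union> set [u x, x, y, u y] = H \<union> u ` H"
      using x y by (auto simp: H'_def)
    ultimately show ?thesis by simp
  qed (simp add: path_cover_empty)
qed

end

section \<open>Covers of coronas and suns\<close>

context simple_rel begin

lemma corona_edge: "corona E C H u \<Longrightarrow> v \<in> H \<Longrightarrow> E v (u v)"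
  unfolding corona_def using sym by blast

lemma corona_disj: "corona E C H u \<Longrightarrow> v \<in> H \<Longrightarrow> w \<in> H \<Longrightarrow> u v \<noteq> w"
  unfolding corona_def by auto

lemma corona_inj: "corona E C H u \<Longrightarrow> v \<in> H \<Longrightarrow> w \<in> H \<Longrightarrow> u v = u w \<longleftrightarrow> v = w"
  unfolding corona_def by (auto dest: inj_onD)

lemma corona_mem: "corona E C H u \<Longrightarrow> v \<in> H \<Longrightarrow> v \<in> C \<and> u v \<in> C"
  unfolding corona_def by auto

lemma corona_cases: "corona E C H u \<Longrightarrow> x \<in> C \<Longrightarrow> x \<in> H \<or> (\<exists>v\<in>H. x = u v)"
  unfolding corona_def by auto

lemma corona_sub_path_cover:
  assumes "corona E C H u" "finite C" "K \<subseteq> H" "has_pm E K"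
  shows "path_cover E (K \<union> u ` K)"
proof (rule pm_path_cover)
  show "finite K" by (rule finite_subset[OF _ assms(2)]) (use assms in \<open>auto simp: corona_def\<close>)
  show "inj_on u K" by (rule inj_on_subset[of u H]) (use assms in \<open>simp_all add: corona_def\<close>)
  show "u ` K \<inter> K = {}" using corona_disj[OF assms(1)] assms(3) by blast
qed (use assms corona_edge in auto)

text \<open>Removing base vertices together with their pendants leaves the corona over the remaining
  base. With \<open>K = {}\<close> it describes the whole of \<open>C\<close>.\<close>

lemma corona_split:
  assumes "corona E C H u" "K \<subseteq> H"
  shows "C - (K \<union> u ` K) = (H - K) \<union> u ` (H - K)"
proof -
  have "u ` (H - K) = u ` H - u ` K" using assms by (intro inj_on_image_set_diff) (auto simp: corona_def)
  moreover have "u x \<notin> H" if "x \<in> H" for x using assms that by (auto simp: corona_def)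
  ultimately show ?thesis using assms by (auto simp: corona_def)
qed

lemma corona_stk2:
  assumes "corona E C H u" "v \<in> H" "d = v \<or> d = u v"
  shows "rooted_cover E 2 {v, u v} d"
proof -
  have e: "E v (u v)" "E (u v) v" "u v \<noteq> v" using corona_edge[OF assms(1,2)] sym irr by metis+
  have "rooted_cover E (Suc 1) (insert v {u v}) v" "rooted_cover E (Suc 1) (insert (u v) {v}) (u v)"
    using e by (intro rooted_cover_cons[OF rooted_cover_sing]; auto)+
  thus ?thesis using assms(3) by (auto simp: numeral_2_eq_2 insert_commute)
qed

text \<open>If \<open>v\<close> is the base vertex \<open>w\<close> or its pendant, the root path is
  the edge between \<open>w\<close> and \<open>u w\<close>; a perfect matching of
  \<open>H - {w}\<close> covers the rest.\<close>

lemma sun_rooted_cover: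
  assumes "sun_set E C" "finite C" "v \<in> C" shows "rooted_cover E 1 C v"
proof (cases "\<exists>x. C = {x}")
  case True thus ?thesis using assms rooted_cover_sing by auto
next
  case False
  then obtain H u where H: "corona E C H u" "fc_set E H" using assms by (auto simp: sun_set_def)
  obtain w where w: "w \<in> H" "v = w \<or> v = u w" using corona_cases[OF H(1) assms(3)] by auto
  have "path_cover E ((H - {w}) \<union> u ` (H - {w}))"
    by (rule corona_sub_path_cover[OF H(1) assms(2)]) (use H w in \<open>auto simp: fc_set_def\<close>)
  moreover have "C - {w, u w} = (H - {w}) \<union> u ` (H - {w})"
    using corona_split[OF H(1), of "{w}"] w by auto
  ultimately have "rooted_cover E 2 ({w, u w} \<union> (C - {w, u w})) v"
    by (intro rooted_cover_Un corona_stk2[OF H(1) w]) auto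
  moreover have "{w, u w} \<union> (C - {w, u w}) = C" using corona_mem[OF H(1) w(1)] by auto
  ultimately show ?thesis using rooted_cover_le[of E 2 C v 1] by simp
qed

text \<open>The vertex \<open>z\<close> is the partner of \<open>v\<close> in a perfect matching of
  \<open>H - {w}\<close>; the other matching edges stay.\<close>

lemma fc_partner:
  assumes "fc_set E H" "v \<in> H" "w \<in> H" "v \<noteq> w"
  obtains z where "z \<in> H" "z \<noteq> v" "z \<noteq> w" "E v z" "has_pm E (H - {w, v, z})"
proof -
  obtain m where m: "\<forall>x\<in>H-{w}. m x \<in> H-{w} \<and> m (m x) = x \<and> E x (m x)"
    using assms by (auto simp: fc_set_def has_pm_def)
  have "has_pm E (H - {w} - {v, m v})" using assms by (intro has_pm_Diff2[OF m]) auto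
  moreover have "H - {w} - {v, m v} = H - {w, v, m v}" by auto
  moreover have "m v \<in> H - {w}" "E v (m v)" using m assms by auto
  ultimately show ?thesis using that[of "m v"] irr by (metis DiffE singletonI)
qed

text \<open>With \<open>z\<close> the partner of \<open>v\<close> in a perfect matching of
  \<open>H - {w}\<close>, the root path is \<open>u v, v, z, u z\<close>, and the remaining matching
  edges give the other paths.\<close>

lemma corona_stk3:
  assumes "finite C" "corona E C H u" "fc_set E H" "v \<in> H" "w \<in> H" "v \<noteq> w"
  shows "rooted_cover E 3 (C - {w, u w}) (u v)"
proof -
  obtain z where z: "z \<in> H" "z \<noteq> v" "z \<noteq> w" "E v z" "has_pm E (H - {w, v, z})"
    using fc_partner[OF assms(3-6)] .
  note dj = corona_disj[OF assms(2)] and ij = corona_inj[OF assms(2)] and ed = corona_edge[OF assms(2)]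
  have "rooted_cover E 2 {z, u z} z" using corona_stk2[OF assms(2) z(1)] by simp
  hence "rooted_cover E (Suc 2) (insert v {z, u z}) v"
    by (rule rooted_cover_cons) (use z assms dj[OF z(1) assms(4)] in auto)
  hence "rooted_cover E (Suc (Suc 2)) (insert (u v) (insert v {z, u z})) (u v)"
    by (rule rooted_cover_cons) (use z assms dj ij ed sym in auto)
  hence 1: "rooted_cover E 3 {u v, v, z, u z} (u v)" by (rule rooted_cover_le) simp
  have 2: "path_cover E ((H - {w,v,z}) \<union> u ` (H - {w,v,z}))"
    by (rule corona_sub_path_cover[OF assms(2,1)]) (use z in auto)
  have 3: "C - {w, v, z, u w, u v, u z} = (H - {w,v,z}) \<union> u ` (H - {w,v,z})"
  proof -
    have "{w, v, z, u w, u v, u z} = {w,v,z} \<union> u ` {w,v,z}" by auto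
    thus ?thesis using corona_split[OF assms(2), of "{w,v,z}"] assms(4,5) z(1) by (simp only:) simp
  qed
  have "rooted_cover E 3 ({u v, v, z, u z} \<union> (C - {w, v, z, u w, u v, u z})) (u v)"
    by (rule rooted_cover_Un[OF 1 2[folded 3]]) blast
  moreover have "{u v, v, z, u z} \<union> (C - {w, v, z, u w, u v, u z}) = C - {w, u w}"
  proof -
    have "u v \<noteq> w" "u v \<noteq> u w" "u w \<noteq> v" "u w \<noteq> z" "u z \<noteq> w" "u z \<noteq> u w"
      by (simp_all add: dj ij assms(4-6) z(1,3))
    thus ?thesis
      using corona_mem[OF assms(2,4)] corona_mem[OF assms(2) z(1)] \<open>v \<noteq> w\<close> \<open>z \<noteq> w\<close> by auto
  qed
  ultimately show ?thesis by simp
qed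

text \<open>Take a neighbour \<open>y\<close> of \<open>v\<close> in \<open>H\<close> and the
  partner \<open>z\<close> of \<open>v\<close> in a perfect matching of \<open>H - {y}\<close>. The
  path \<open>u z, z, v, y, u y\<close> passes through \<open>v\<close> without its pendant, and the
  other matching edges cover the rest.\<close>

lemma corona_minus_leaf:
  assumes "finite C" "corona E C H u" "fc_set E H" "v \<in> H" "H \<noteq> {v}"
  shows "path_cover E (C - {u v})"
proof -
  obtain w where w: "w \<in> H" "v \<noteq> w" using assms by auto
  obtain y where y: "y \<in> H" "y \<noteq> v" "E v y" using fc_partner[OF assms(3,4) w] by metis
  obtain z where z: "z \<in> H" "z \<noteq> v" "z \<noteq> y" "E v z" "has_pm E (H - {y, v, z})"
    using fc_partner[OF assms(3,4) y(1)] y by metis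
  note dj = corona_disj[OF assms(2)] and ij = corona_inj[OF assms(2)] and ed = corona_edge[OF assms(2)]
  have "rooted_cover E 2 {z, u z} z" using corona_stk2[OF assms(2) z(1)] by simp
  hence "rooted_cover E (Suc 2) (insert v {z, u z}) v"
    by (rule rooted_cover_cons) (use z assms dj[OF z(1) assms(4)] in auto)
  moreover have "rooted_cover E 2 {y, u y} y" using corona_stk2[OF assms(2) y(1)] by simp
  ultimately have 1: "path_cover E (insert v {z, u z} \<union> {y, u y})"
    by (rule rooted_cover_join) (use y z dj ij assms(4) in auto)
  have 2: "path_cover E ((H - {y,v,z}) \<union> u ` (H - {y,v,z}))"
    by (rule corona_sub_path_cover[OF assms(2,1)]) (use z in auto)
  have 3: "C - {y, v, z, u y, u v, u z} = (H - {y,v,z}) \<union> u ` (H - {y,v,z})"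
  proof -
    have "{y, v, z, u y, u v, u z} = {y,v,z} \<union> u ` {y,v,z}" by auto
    thus ?thesis using corona_split[OF assms(2), of "{y,v,z}"] assms(4) y(1) z(1) by (simp only:) simp
  qed
  have "path_cover E ((insert v {z, u z} \<union> {y, u y}) \<union> (C - {y, v, z, u y, u v, u z}))"
    by (rule path_cover_Un[OF 1 2[folded 3]]) blast
  moreover have "(insert v {z, u z} \<union> {y, u y}) \<union> (C - {y, v, z, u y, u v, u z}) = C - {u v}"
  proof -
    have "u v \<noteq> v" "u v \<noteq> z" "u v \<noteq> y" "u z \<noteq> u v" "u y \<noteq> u v"
      by (simp_all add: dj ij assms(4) y(1,2) z(1,2))
    thus ?thesis
      using corona_mem[OF assms(2,4)] corona_mem[OF assms(2) z(1)] corona_mem[OF assms(2) y(1)] by auto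
  qed
  ultimately show ?thesis by simp
qed

text \<open>The two sticks \<open>Q\<close> and \<open>B\<close> are attached to the sun \<open>A\<close> at \<open>d\<close> and \<open>y\<close>; the covering can fail when both
\<open>d\<close> and \<open>y\<close> are in the factor-critical base \<open>H\<close>.\<close>

lemma sun_two_sticks:
  assumes A: "finite A" "corona E A H u" "fc_set E H" "v \<in> H"
    and Q: "rooted_cover E 2 Q s" and B: "rooted_cover E 1 B z" and e: "E s d" "E y z"
    and dj: "Q \<inter> A = {}" "Q \<inter> B = {}" "A \<inter> B = {}"
    and c: "d = v \<and> y = u v \<or> d = u v \<and> y = v \<or> y = u v \<and> d \<in> A \<and> H \<noteq> {v}"
  shows "path_cover E (Q \<union> A \<union> B)"
proof -
  have through: "path_cover E (Q \<union> A \<union> B)" if c: "d = v \<and> y = u v \<or> d = u v \<and> y = v"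
  proof -
    have mem: "v \<in> A" "u v \<in> A" using corona_mem[OF A(2,4)] by auto
    have ed: "E d y" "d \<noteq> y" using corona_edge[OF A(2,4)] c sym irr by metis+
    have "rooted_cover E (Suc 1) (insert y B) y" by (rule rooted_cover_cons[OF B]) (use e mem c dj in auto)
    hence 1: "rooted_cover E (Suc (Suc 1)) (insert d (insert y B)) d" by (rule rooted_cover_cons) (use ed mem c dj in auto)
    have "A - {v, u v} = (H - {v}) \<union> u ` (H - {v})" using A(4) corona_split[OF A(2), of "{v}"] by auto
    hence 2: "path_cover E (A - {v, u v})"
      using corona_sub_path_cover[OF A(2,1), of "H - {v}"] A(3,4) by (simp add: fc_set_def)
    have 3: "rooted_cover E (Suc (Suc 1)) (insert d (insert y B) \<union> (A - {v, u v})) d"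
      by (rule rooted_cover_Un[OF 1 2]) (use c dj in auto)
    have "path_cover E (Q \<union> (insert d (insert y B) \<union> (A - {v, u v})))"
      by (rule rooted_cover_join[OF Q 3 e(1)]) (use c dj mem in auto)
    moreover have "Q \<union> (insert d (insert y B) \<union> (A - {v, u v})) = Q \<union> A \<union> B" using c mem by auto
    ultimately show ?thesis by simp
  qed
  show ?thesis
  proof (cases "d = v \<and> y = u v \<or> d = u v \<and> y = v")
    case False
    hence y: "y = u v" and d: "d \<in> A" "d \<noteq> v" and H: "H \<noteq> {v}" using c by auto
    have mem: "v \<in> A" "u v \<in> A" using corona_mem[OF A(2,4)] by auto
    show ?thesis
    proof (cases "d = u v")
      case True
      have 1: "rooted_cover E (Suc 1) (insert y B) y" by (rule rooted_cover_cons[OF B]) (use e mem y dj in auto)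
      have "path_cover E (Q \<union> insert y B)" by (rule rooted_cover_join[OF Q 1]) (use e True y dj mem in auto)
      hence "path_cover E ((Q \<union> insert y B) \<union> (A - {u v}))"
        by (rule path_cover_Un[OF _ corona_minus_leaf[OF A H]]) (use y dj in auto)
      moreover have "(Q \<union> insert y B) \<union> (A - {u v}) = Q \<union> A \<union> B" using y mem by auto
      ultimately show ?thesis by simp
    next
      case False
      obtain w where w: "w \<in> H" "d = w \<or> d = u w" using corona_cases[OF A(2) d(1)] by auto
      have vw: "v \<noteq> w" using w d False by auto
      have memw: "w \<in> A" "u w \<in> A" using corona_mem[OF A(2) w(1)] by auto
      have 1: "path_cover E ((A - {w, u w}) \<union> B)"
        by (rule rooted_cover_join[OF corona_stk3[OF A w(1) vw] B]) (use e y dj in auto)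
      have 2: "path_cover E (Q \<union> {w, u w})"
        by (rule rooted_cover_join[OF Q corona_stk2[OF A(2) w] e(1)]) (use dj memw in auto)
      have "path_cover E ((Q \<union> {w, u w}) \<union> ((A - {w, u w}) \<union> B))"
        by (rule path_cover_Un[OF 2 1]) (use dj memw in auto)
      moreover have "(Q \<union> {w, u w}) \<union> ((A - {w, u w}) \<union> B) = Q \<union> A \<union> B" using memw by auto
      ultimately show ?thesis by simp
    qed
  qed (rule through)
qed

text \<open>Inside \<open>C\<close> the only neighbour of \<open>u x\<close> is \<open>x\<close>, so
  \<open>u x\<close> cannot be an inner vertex of a path. Order at least 3 makes the path continue
  beyond \<open>x\<close>.\<close>

lemma corona_leaf_end:
  assumes "corona E C H u" "x \<in> H" "simple_path E p" "3 \<le> length p" "set p \<subseteq> C" "u x \<in> set p"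
  shows "\<exists>r. r \<noteq> [] \<and> (p = u x # x # r \<or> rev p = u x # x # r)"
proof -
  have leaf: "y = x" if "E (u x) y \<or> E y (u x)" "y \<in> set p" for y
    using that assms sym unfolding corona_def by blast
  obtain as bs where p: "p = as @ u x # bs" using assms(6) by (auto simp: in_set_conv_decomp)
  show ?thesis
  proof (cases as rule: rev_cases)
    case Nil
    then obtain b bs' where b: "bs = b # bs'" "bs' \<noteq> []" using p assms(4) by (cases bs; cases "tl bs"; auto)
    have "E (u x) b" using assms(3) p Nil b by (auto simp: simple_path_def)
    hence "b = x" using leaf[of b] p b by auto
    thus ?thesis using p Nil b by auto
  next
    case (snoc as' a)
    have "E a (u x)" using assms(3) p snoc by (auto simp: simple_path_def successively_append_iff)
    hence a: "a = x" using leaf[of a] p snoc by auto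
    have "bs = []"
    proof (cases bs)
      case (Cons b bs')
      have "E (u x) b" using assms(3) p Cons by (auto simp: simple_path_def successively_append_iff)
      hence "b = x" using leaf[of b] p Cons by auto
      thus ?thesis using assms(3) p snoc Cons a by (auto simp: simple_path_def)
    qed
    moreover have "as' \<noteq> []" using p assms(4) snoc calculation by auto
    ultimately show ?thesis using p snoc a by auto
  qed
qed

text \<open>Every path of such a cover has the form \<open>u x, x, y, u y\<close>.\<close>

lemma path_cover_corona_pm:
  assumes co: "corona E C H u" and "path_cover E C" shows "has_pm E H"
proof -
  obtain P where P: "\<And>p. p \<in> P \<Longrightarrow> simple_path E p" "\<And>p. p \<in> P \<Longrightarrow> 3 \<le> length p" "(\<Union>p\<in>P. set p) = C"
     "\<And>p q. p\<in>P \<Longrightarrow> q\<in>P \<Longrightarrow> p \<noteq> q \<Longrightarrow> set p \<inter> set q = {}"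
    using path_cover_set[OF assms(2)] by metis
  define M where "M x y \<longleftrightarrow> y \<in> H \<and> (\<exists>p\<in>P. p = [u x, x, y, u y] \<or> rev p = [u x, x, y, u y])" for x y
  have ex: "\<exists>y. M x y" if x: "x \<in> H" for x
  proof -
    have "u x \<in> C" using corona_mem[OF co x] by auto
    then obtain p where p: "p \<in> P" "u x \<in> set p" using P(3) by auto
    obtain r where r: "r \<noteq> []" "p = u x # x # r \<or> rev p = u x # x # r"
      using corona_leaf_end[OF co x P(1,2)[OF p(1)] _ p(2)] P(3) p(1) by blast
    define q where "q = u x # x # r"
    obtain y t where y: "r = y # t" using r by (cases r) auto
    have q: "simple_path E q" "q = p \<or> q = rev p"
    proof -
      show "q = p \<or> q = rev p" using r q_def by (metis rev_rev_ident)
      moreover have "simple_path E (rev p)" using P(1)[OF p(1)] sym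
        by (auto simp: simple_path_def successively_rev intro: successively_mono)
      ultimately show "simple_path E q" using P(1)[OF p(1)] by auto
    qed
    have sq: "set q = set p" using q(2) by auto
    have lq: "3 \<le> length q" using q(2) P(2)[OF p(1)] by auto
    have exy: "E x y" and dist: "distinct (u x # x # y # t)" using q(1) q_def y by (auto simp: simple_path_def)
    have yC: "y \<in> C" using sq P(3) p(1) q_def y by auto
    have yH: "y \<in> H"
    proof (rule ccontr)
      assume "y \<notin> H"
      then obtain w where w: "w \<in> H" "y = u w" using corona_cases[OF co yC] by auto
      hence "x = w" using co exy sym[OF exy] corona_mem[OF co x] by (auto simp: corona_def)
      thus False using dist w by auto
    qed
    \<comment> \<open>The path through the pendant of \<open>y\<close> also contains
      \<open>y\<close>, so it is the same path. Both of its ends are then known, which leaves only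
      \<open>u x, x, y, u y\<close>.\<close>
    have "u y \<in> C" using corona_mem[OF co yH] by auto
    then obtain p' where p': "p' \<in> P" "u y \<in> set p'" using P(3) by auto
    obtain r' where r': "p' = u y # y # r' \<or> rev p' = u y # y # r'"
      using corona_leaf_end[OF co yH P(1,2)[OF p'(1)] _ p'(2)] P(3) p'(1) by blast
    have "y \<in> set p'" using r' by (metis list.set_intros set_rev)
    moreover have "y \<in> set p" using sq q_def y by auto
    ultimately have pp: "p' = p" using P(4)[OF p'(1) p(1)] by auto
    have "set q \<subseteq> C" using sq P(3) p(1) by auto
    then obtain r'' where r'': "q = u y # y # r'' \<or> rev q = u y # y # r''"
      using corona_leaf_end[OF co yH q(1) lq _] p'(2) pp sq by metis
    have xy: "x \<noteq> y" using dist by auto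
    have "q \<noteq> u y # y # r''" using q_def xy by auto
    hence rq: "q = rev r'' @ [y, u y]" using r'' by (metis append.assoc append_Cons append_Nil rev.simps(2) rev_swap)
    have "t = [u y]"
    proof -
      obtain a b where ab: "rev r'' = [a, b]"
      proof -
        have "q = [u x, x] @ y # t" using q_def y by simp
        hence "[u x, x] = rev r''"
          using rq q(1) append_Cons_eq_iff[of y "[u x, x]" t "rev r''" "[u y]"]
          by (auto simp: simple_path_def)
        thus ?thesis using that by metis
      qed
      thus ?thesis using rq q_def y by auto
    qed
    hence "q = [u x, x, y, u y]" using q_def y by auto
    hence "M x y" unfolding M_def using yH p(1) q(2) by (metis rev_rev_ident)
    thus ?thesis by auto
  qed
  have symM: "M y x" if "M x y" "x \<in> H" for x y
    using that unfolding M_def by (auto intro: rev_bexI)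
  have uniq: "y = z" if "M x y" "M x z" for x y z
  proof -
    obtain p q where p: "p\<in>P" "p = [u x, x, y, u y] \<or> rev p = [u x, x, y, u y]"
      and q: "q\<in>P" "q = [u x, x, z, u z] \<or> rev q = [u x, x, z, u z]"
      using \<open>M x y\<close> \<open>M x z\<close> by (auto simp: M_def)
    have "x \<in> set p" "x \<in> set q" using p(2) q(2) by (metis list.set_intros set_rev)+
    hence "p = q" using P(4) p q by blast
    moreover have "distinct p" "distinct (rev p)" using P(1)[OF p(1)] by (auto simp: simple_path_def)
    ultimately show ?thesis using p(2) q(2) by auto
  qed
  have eM: "E x y" if "M x y" for x y
    using that P(1) sym unfolding M_def by (fastforce simp: simple_path_def successively_rev dest: arg_cong[of _ _ rev])
  define m where "m x = (SOME y. M x y)" for x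
  have m: "M x (m x)" if "x \<in> H" for x unfolding m_def using ex[OF that] by (rule someI_ex)
  show ?thesis unfolding has_pm_def
  proof (rule exI[of _ m], intro ballI conjI)
    fix x assume x: "x \<in> H"
    show mH: "m x \<in> H" using m[OF x] by (simp add: M_def)
    show "E x (m x)" using eM m x by auto
    show "m (m x) = x" using uniq[OF m[OF mH] symM[OF m[OF x] x]] .
  qed
qed

end

section \<open>Hall's theorem\<close>

text \<open>Induction on \<open>I\<close>. If a nonempty proper subfamily \<open>J\<close> is tight,
  it is served first and the rest avoids the elements used. Otherwise every nonempty proper
  subfamily has an element to spare, so one index may take any of its elements.\<close>

lemma hall_marriage:
  assumes "finite I" "\<And>i. i \<in> I \<Longrightarrow> finite (F i)" "\<And>J. J \<subseteq> I \<Longrightarrow> card J \<le> card (\<Union>i\<in>J. F i)"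
  shows "\<exists>f. inj_on f I \<and> (\<forall>i\<in>I. f i \<in> F i)"
  using assms
proof (induction I arbitrary: F rule: finite_psubset_induct)
  case (psubset I)
  note finI = psubset.hyps(1) and finF = psubset.prems(1) and hall = psubset.prems(2)
  show ?case
  proof (cases "I = {}")
    case False
    show ?thesis
    proof (cases "\<exists>J. J \<subset> I \<and> J \<noteq> {} \<and> card (\<Union>i\<in>J. F i) = card J")
      case True
      then obtain J where J: "J \<subset> I" "J \<noteq> {}" "card (\<Union>i\<in>J. F i) = card J" by auto
      define N where "N = (\<Union>i\<in>J. F i)"
      have finJ: "finite J" "finite N" using J finI finF by (auto simp: N_def finite_subset)
      obtain f where f: "inj_on f J" "\<forall>i\<in>J. f i \<in> F i"
      proof -
        have "\<exists>f. inj_on f J \<and> (\<forall>i\<in>J. f i \<in> F i)"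
          by (rule psubset.IH[OF J(1)]) (use finF hall J(1) in auto)
        thus ?thesis using that by blast
      qed
      \<comment> \<open>Hall's condition survives the removal of \<open>N\<close>: apply it to
        \<open>K \<union> J\<close> and subtract the tight equality for \<open>J\<close>.\<close>
      have "\<exists>g. inj_on g (I - J) \<and> (\<forall>i\<in>I - J. g i \<in> F i - N)"
      proof (rule psubset.IH)
        show "I - J \<subset> I" using J by auto
        show "finite (F i - N)" if "i \<in> I - J" for i using that finF by auto
        fix K assume K: "K \<subseteq> I - J"
        have finK: "finite K" using K finI by (auto intro: finite_subset)
        have "card K + card J = card (K \<union> J)" using K finK finJ by (subst card_Un_disjoint) auto
        also have "\<dots> \<le> card (\<Union>i\<in>K \<union> J. F i)" using K J by (intro hall) auto
        also have "(\<Union>i\<in>K \<union> J. F i) = (\<Union>i\<in>K. F i - N) \<union> N" by (auto simp: N_def)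
        also have "card \<dots> \<le> card (\<Union>i\<in>K. F i - N) + card N" by (rule card_Un_le)
        finally show "card K \<le> card (\<Union>i\<in>K. F i - N)" using J(3) by (simp add: N_def)
      qed
      then obtain g where g: "inj_on g (I - J)" "\<forall>i\<in>I - J. g i \<in> F i - N" by auto
      define h where "h i = (if i \<in> J then f i else g i)" for i
      have fN: "f i \<in> N" if "i \<in> J" for i using f that by (auto simp: N_def)
      have "inj_on h I"
      proof (rule inj_onI)
        fix x y assume xy: "x \<in> I" "y \<in> I" "h x = h y"
        have "x \<in> J \<longleftrightarrow> y \<in> J" using xy fN g(2) unfolding h_def by (metis DiffD2 DiffI)
        thus "x = y" using xy inj_onD[OF f(1), of x y] inj_onD[OF g(1), of x y] by (auto simp: h_def)
      qed
      moreover have "\<forall>i\<in>I. h i \<in> F i" using f g by (auto simp: h_def)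
      ultimately show ?thesis by auto
    next
      case no: False
      obtain i where i: "i \<in> I" using False by auto
      have "F i \<noteq> {}" using hall[of "{i}"] i by auto
      then obtain x where x: "x \<in> F i" by auto
      have "\<exists>g. inj_on g (I - {i}) \<and> (\<forall>j\<in>I - {i}. g j \<in> F j - {x})"
      proof (rule psubset.IH)
        show "I - {i} \<subset> I" using i by auto
        show "finite (F j - {x})" if "j \<in> I - {i}" for j using that finF by auto
        fix K assume K: "K \<subseteq> I - {i}"
        show "card K \<le> card (\<Union>j\<in>K. F j - {x})"
        proof (cases "K = {}")
          case False
          have "card K \<le> card (\<Union>j\<in>K. F j)" "card (\<Union>j\<in>K. F j) \<noteq> card K" using hall[of K] no K i False by auto
          moreover have "(\<Union>j\<in>K. F j - {x}) = (\<Union>j\<in>K. F j) - {x}" by auto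
          moreover have "finite (\<Union>j\<in>K. F j)" using K finI finF by (auto intro: finite_subset)
          ultimately show ?thesis by (auto simp: card_Diff_singleton_if)
        qed simp
      qed
      then obtain g where g: "inj_on g (I - {i})" "\<forall>j\<in>I - {i}. g j \<in> F j - {x}" by auto
      have "inj_on (g(i := x)) I" using g by (auto simp: inj_on_def)
      moreover have "\<forall>j\<in>I. (g(i := x)) j \<in> F j" using g x by auto
      ultimately show ?thesis by blast
    qed
  qed auto
qed

text \<open>Each \<open>s\<close> is split into the two copies \<open>(s, False)\<close> and
  \<open>(s, True)\<close>, and Hall's theorem assigns copies to the items of \<open>I\<close>. As
  \<open>card I = 2 * card S\<close>, the injection is onto, and \<open>g\<close> is its
  inverse.\<close>

lemma hall_two:
  assumes "finite S" "finite I" "card I = 2 * card S"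
    and "\<And>J. J \<subseteq> I \<Longrightarrow> card J \<le> 2 * card {s\<in>S. \<exists>i\<in>J. R i s}"
  shows "\<exists>g. bij_betw g (S \<times> (UNIV :: bool set)) I \<and> (\<forall>s\<in>S. \<forall>b. R (g (s, b)) s)"
proof -
  define F where "F i = {s\<in>S. R i s} \<times> (UNIV :: bool set)" for i
  have "\<exists>f. inj_on f I \<and> (\<forall>i\<in>I. f i \<in> F i)"
  proof (rule hall_marriage)
    fix J assume J: "J \<subseteq> I"
    have "(\<Union>i\<in>J. F i) = {s\<in>S. \<exists>i\<in>J. R i s} \<times> (UNIV :: bool set)" by (auto simp: F_def)
    thus "card J \<le> card (\<Union>i\<in>J. F i)" using assms(4)[OF J] by (simp add: card_cartesian_product)
  qed (use assms in \<open>auto simp: F_def\<close>)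
  then obtain f where f: "inj_on f I" "\<forall>i\<in>I. f i \<in> F i" by auto
  have "f ` I = S \<times> UNIV"
    by (rule card_subset_eq) (use assms f in \<open>auto simp: card_image card_cartesian_product F_def\<close>)
  hence b: "bij_betw f I (S \<times> UNIV)" using f by (simp add: bij_betw_def)
  show ?thesis
  proof (intro exI[of _ "the_inv_into I f"] conjI ballI allI)
    show "bij_betw (the_inv_into I f) (S \<times> UNIV) I" using b by (rule bij_betw_the_inv_into)
    fix s b' assume s: "s \<in> S"
    then obtain i where i: "i \<in> I" "f i = (s, b')" using b unfolding bij_betw_def
      by (metis SigmaI UNIV_I imageE)
    hence "the_inv_into I f (s, b') = i" using the_inv_into_f_f[OF f(1)] by metis
    thus "R (the_inv_into I f (s, b')) s" using i f(2) by (auto simp: F_def)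
  qed
qed

section \<open>Kaneko's criterion\<close>

definition sun_bounded :: "('a \<Rightarrow> 'a \<Rightarrow> bool) \<Rightarrow> 'a set \<Rightarrow> bool" where
  "sun_bounded E V \<longleftrightarrow> finite V \<and> (\<forall>X\<subseteq>V. sun_number E (V - X) \<le> 2 * card X)"

text \<open>This is what remains of \<open>sun_bounded\<close> after disconnected sets and sets with
  a nonempty tight \<open>X\<close> have been treated.\<close>

definition strictly_sun_bounded :: "('a \<Rightarrow> 'a \<Rightarrow> bool) \<Rightarrow> 'a set \<Rightarrow> bool" where
  "strictly_sun_bounded E V \<longleftrightarrow> finite V \<and> conn_set E V \<and> \<not> sun_set E V \<and>
     (\<forall>X\<subseteq>V. X \<noteq> {} \<longrightarrow> sun_number E (V - X) < 2 * card X)"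

definition leaf_of :: "('a \<Rightarrow> 'a \<Rightarrow> bool) \<Rightarrow> 'a set \<Rightarrow> 'a \<Rightarrow> 'a \<Rightarrow> bool" where
  "leaf_of E V l w \<longleftrightarrow> l \<in> V \<and> w \<in> V \<and> (\<forall>y\<in>V. E l y \<longleftrightarrow> y = w)"

lemma no_edge_mono: "no_edge E A B \<Longrightarrow> A' \<subseteq> A \<Longrightarrow> B' \<subseteq> B \<Longrightarrow> no_edge E A' B'"
  unfolding no_edge_def by blast

lemma has_pm_empty[simp]: "has_pm E {}"
  by (simp add: has_pm_def)

lemma sun_boundedD: "sun_bounded E V \<Longrightarrow> X \<subseteq> V \<Longrightarrow> sun_number E (V - X) \<le> 2 * card X"
  by (simp add: sun_bounded_def)

lemma strictly_sun_boundedD: "strictly_sun_bounded E V \<Longrightarrow> X \<subseteq> V \<Longrightarrow> X \<noteq> {} \<Longrightarrow> sun_number E (V - X) < 2 * card X"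
  by (simp add: strictly_sun_bounded_def)

context simple_rel begin

section \<open>Additivity of sun counts and disconnected vertex sets\<close>

lemma sun_number_split:
  assumes "no_edge E A B" "A \<inter> B = {}" "finite A" "finite B"
  shows "sun_number E (A \<union> B) = sun_number E A + sun_number E B"
  using sun_number_Un[OF assms(1) no_edge_sym[OF assms(1)] assms(2-4)] .

lemma sun_bounded_part:
  assumes "sun_bounded E (A \<union> B)" "no_edge E A B" "A \<inter> B = {}" shows "sun_bounded E A"
  unfolding sun_bounded_def
proof (intro conjI allI impI)
  show "finite A" using assms by (simp add: sun_bounded_def)
  fix X assume X: "X \<subseteq> A"
  have "sun_number E ((A - X) \<union> B) = sun_number E (A - X) + sun_number E B"
    by (rule sun_number_split) (use assms in \<open>auto simp: sun_bounded_def intro: no_edge_mono\<close>)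
  moreover have "(A - X) \<union> B = A \<union> B - X" using X assms(3) by auto
  moreover have "sun_number E (A \<union> B - X) \<le> 2 * card X" using assms(1) X by (auto simp: sun_bounded_def)
  ultimately show "sun_number E (A - X) \<le> 2 * card X" by simp
qed

lemma path_cover_disconnected:
  assumes "sun_bounded E V" "\<not> conn_set E V" and IH: "\<And>W. W \<subset> V \<Longrightarrow> sun_bounded E W \<Longrightarrow> path_cover E W"
  shows "path_cover E V"
proof (cases "V = {}")
  case False
  then obtain B where B: "B \<subseteq> V" "B \<noteq> {}" "no_edge E B (V - B)" "B \<noteq> V"
    using assms(2) by (auto simp: conn_set_def)
  have V: "B \<union> (V - B) = V" "(V - B) \<union> B = V" using B by auto
  have "path_cover E B" by (rule IH) (use B V sun_bounded_part[of B "V - B"] assms in auto)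
  moreover have "path_cover E (V - B)"
    by (rule IH) (use B V sun_bounded_part[of "V - B" B] no_edge_sym[OF B(3)] assms in auto)
  ultimately have "path_cover E (B \<union> (V - B))" by (rule path_cover_Un) auto
  thus ?thesis using V by simp
qed (simp add: path_cover_empty)

section \<open>Tight vertex sets\<close>

lemma comps_Union: "D \<subseteq> comps E W \<Longrightarrow> comps E (\<Union>D) = D"
proof (intro equalityI subsetI)
  assume D: "D \<subseteq> comps E W"
  have 1: "C \<in> comps E (\<Union>D)" if "C \<in> D" for C
  proof -
    have "\<Union>D - C \<subseteq> W - C" using D comps_subset by blast
    thus ?thesis using D that unfolding comps_def by (auto intro: no_edge_mono)
  qed
  fix C
  { assume "C \<in> D" thus "C \<in> comps E (\<Union>D)" by (rule 1) }
  assume C: "C \<in> comps E (\<Union>D)"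
  then obtain x where x: "x \<in> C" using comps_ne by blast
  then obtain C' where C': "C' \<in> D" "x \<in> C'" using comps_subset[OF C] by blast
  have "C = C'" by (rule comps_disj[OF C 1[OF C'(1)]]) (use x C' in auto)
  thus "C \<in> D" using C' by simp
qed

lemma no_edge_Union: "D \<subseteq> comps E W \<Longrightarrow> no_edge E (\<Union>D) (W - \<Union>D)"
  unfolding comps_def no_edge_def by blast

lemma sun_number_Union_suns: "D \<subseteq> suns E W \<Longrightarrow> sun_number E (\<Union>D) = card D"
proof -
  assume D: "D \<subseteq> suns E W"
  hence "comps E (\<Union>D) = D" by (intro comps_Union) (auto simp: suns_def)
  hence "suns E (\<Union>D) = D" using D by (auto simp: suns_def)
  thus ?thesis by (simp add: sun_number_def)
qed

text \<open>Members of \<open>J\<close> remain components when only their own neighbours in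
  \<open>S\<close> are deleted. Combined with a bound on sun counts, this is the source of Hall's
  condition.\<close>

lemma sun_neighbours:
  assumes "finite V" "S \<subseteq> V" "J \<subseteq> suns E (V - S)"
  shows "card J \<le> sun_number E (V - {s\<in>S. \<exists>C\<in>J. \<exists>c\<in>C. E s c})"
proof -
  define X where "X = {s\<in>S. \<exists>C\<in>J. \<exists>c\<in>C. E s c}"
  have "J \<subseteq> suns E (V - X)"
  proof
    fix C assume C: "C \<in> J"
    hence c: "C \<subseteq> V - S" "conn_set E C" "no_edge E C (V - S - C)" "sun_set E C"
      using assms(3) by (auto simp: suns_def comps_def)
    have "no_edge E C (V - X - C)"
      unfolding no_edge_def
    proof (intro ballI)
      fix a b assume a: "a \<in> C" and b: "b \<in> V - X - C"
      show "\<not> E a b"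
      proof (cases "b \<in> S")
        case True thus ?thesis using a b C sym[of a b] by (auto simp: X_def)
      next
        case False thus ?thesis using a b c(3) by (auto simp: no_edge_def)
      qed
    qed
    thus "C \<in> suns E (V - X)" using c assms by (auto simp: suns_def comps_def X_def)
  qed
  thus ?thesis unfolding sun_number_def X_def[symmetric] by (intro card_mono finite_suns) (use assms(1) in auto)
qed

lemma suns_props:
  assumes "C \<in> suns E (V - S)" "finite V" shows "C \<subseteq> V" "C \<inter> S = {}" "finite C" "sun_set E C" "C \<noteq> {}"
  using assms comps_subset[of C E "V - S"] comps_ne[of C E "V - S"]
  by (auto simp: suns_def intro: finite_subset)

lemma suns_disj:
  "C \<in> suns E W \<Longrightarrow> C' \<in> suns E W \<Longrightarrow> C \<noteq> C' \<Longrightarrow> C \<inter> C' = {}"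
  using comps_disj[of C E W C'] by (auto simp: suns_def)

text \<open>For each \<open>s\<close> one path runs out of the first sun through \<open>s\<close>
  into the second, and \<open>sun_rooted_cover\<close> covers what is left of both suns.\<close>

lemma pairs_path_cover:
  assumes "finite V" "T \<subseteq> S" "S \<subseteq> V" "inj_on g (T \<times> (UNIV::bool set))"
    and g: "\<And>s b. s \<in> T \<Longrightarrow> g (s, b) \<in> suns E (V - S)" "\<And>s b. s \<in> T \<Longrightarrow> \<exists>c\<in>g (s, b). E s c"
  shows "path_cover E (\<Union>s\<in>T. insert s (g (s, False) \<union> g (s, True)))"
proof (rule path_cover_UN)
  show "finite T" by (rule finite_subset[of T V]) (use assms in auto)
  have dj: "g (s, b) \<inter> g (t, b') = {}" if "s \<in> T" "t \<in> T" "(s, b) \<noteq> (t, b')" for s t b b'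
    by (rule suns_disj[OF g(1)[OF that(1)] g(1)[OF that(2)]])
       (use that assms(4) in \<open>auto dest: inj_onD\<close>)
  fix s assume s: "s \<in> T"
  have st: "rooted_cover E 1 (g (s, b)) c" if "c \<in> g (s, b)" for b c
    using suns_props[OF g(1)[OF s, of b] assms(1)] that by (intro sun_rooted_cover) auto
  have nin: "s \<notin> g (s, b)" for b using suns_props(2)[OF g(1)[OF s, of b] assms(1)] s assms(2) by auto
  obtain c d where c: "c \<in> g (s, False)" "E s c" and d: "d \<in> g (s, True)" "E s d"
    using g(2)[OF s] by meson
  have "path_cover E (insert s (g (s, False)) \<union> g (s, True))"
    by (rule rooted_cover_join[OF rooted_cover_cons[OF st[OF c(1)] c(2) nin] st[OF d(1)] d(2)])
       (use nin dj[OF s s, of False True] in auto)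
  thus "path_cover E (insert s (g (s, False) \<union> g (s, True)))" by simp
next
  fix s t assume st: "s \<in> T" "t \<in> T" "s \<noteq> t"
  have dj: "g (s, b) \<inter> g (t, b') = {}" for b b'
    by (rule suns_disj[OF g(1)[OF st(1)] g(1)[OF st(2)]])
       (use st assms(4) in \<open>auto dest: inj_onD\<close>)
  have "x \<notin> g (s, b)" "x \<notin> g (t, b)" if "x \<in> S" for x b
    using suns_props(2)[OF g(1)[OF st(1), of b] assms(1)] suns_props(2)[OF g(1)[OF st(2), of b] assms(1)] that by auto
  moreover have "s \<in> S" "t \<in> S" using st assms(2) by auto
  ultimately show "insert s (g (s, False) \<union> g (s, True)) \<inter> insert t (g (t, False) \<union> g (t, True)) = {}"
    using dj st(3) by (simp add: Int_Un_distrib Int_Un_distrib2)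
qed

text \<open>The suns of \<open>V - S\<close> are unaffected by deleting \<open>X\<close> outside of
  them, so they simply add to the count.\<close>

lemma rest_bound:
  assumes "finite V" "X \<subseteq> V - S - \<Union>(suns E (V - S))"
  shows "sun_number E (V - S - \<Union>(suns E (V - S)) - X) + sun_number E (V - S) = sun_number E (V - (S \<union> X))"
proof -
  define U where "U = \<Union>(suns E (V - S))"
  have U: "U \<subseteq> V - S" using comps_subset by (auto simp: U_def suns_def)
  have ne: "no_edge E U (V - S - U)" unfolding U_def by (rule no_edge_Union) (auto simp: suns_def)
  have "sun_number E (U \<union> (V - S - U - X)) = sun_number E U + sun_number E (V - S - U - X)"
    by (rule sun_number_split) (use ne U assms in \<open>auto intro: no_edge_mono finite_subset\<close>)
  moreover have "U \<union> (V - S - U - X) = V - (S \<union> X)" using U assms(2) by (auto simp: U_def[symmetric])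
  moreover have "sun_number E U = sun_number E (V - S)" unfolding U_def by (subst sun_number_Union_suns) (auto simp: sun_number_def)
  ultimately show ?thesis by (simp add: U_def)
qed

text \<open>\<open>sun_neighbours\<close> and the bound on the set of neighbours give Hall's
  condition. The set \<open>R\<close> outside \<open>S\<close> and the suns inherits the bound: a
  deletion \<open>X\<close> in it is compared with the deletion \<open>S \<union> X\<close> in
  \<open>V\<close>, and the \<open>2 * card S\<close> suns cancel.\<close>

lemma path_cover_tight:
  assumes sun_bounded: "sun_bounded E V" and S: "S \<subseteq> V" "S \<noteq> {}" "sun_number E (V - S) = 2 * card S"
    and IH: "\<And>W. W \<subset> V \<Longrightarrow> sun_bounded E W \<Longrightarrow> path_cover E W"
  shows "path_cover E V"
proof -
  have fin: "finite V" "finite S" using sun_bounded S finite_subset by (auto simp: sun_bounded_def)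
  define I where "I = suns E (V - S)"
  have "\<exists>g. bij_betw g (S \<times> (UNIV::bool set)) I \<and> (\<forall>s\<in>S. \<forall>b. \<exists>c\<in>g (s, b). E s c)"
  proof (rule hall_two)
    show "finite I" "card I = 2 * card S" using finite_suns fin S by (auto simp: I_def sun_number_def)
    fix J assume "J \<subseteq> I"
    hence "card J \<le> sun_number E (V - {s\<in>S. \<exists>C\<in>J. \<exists>c\<in>C. E s c})"
      by (intro sun_neighbours) (use fin S in \<open>auto simp: I_def\<close>)
    also have "\<dots> \<le> 2 * card {s\<in>S. \<exists>C\<in>J. \<exists>c\<in>C. E s c}"
    proof -
      have "{s\<in>S. \<exists>C\<in>J. \<exists>c\<in>C. E s c} \<subseteq> V" using S by auto
      thus ?thesis by (rule sun_boundedD[OF sun_bounded])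
    qed
    finally show "card J \<le> 2 * card {s\<in>S. \<exists>C\<in>J. \<exists>c\<in>C. E s c}" .
  qed (use fin in auto)
  then obtain g where g: "bij_betw g (S \<times> (UNIV::bool set)) I" "\<forall>s\<in>S. \<forall>b. \<exists>c\<in>g (s, b). E s c" by auto
  define R where "R = V - S - \<Union>I"
  have 1: "path_cover E (\<Union>s\<in>S. insert s (g (s, False) \<union> g (s, True)))"
    by (rule pairs_path_cover[OF fin(1) subset_refl S(1)]) (use g in \<open>auto simp: bij_betw_def I_def\<close>)
  have 2: "path_cover E R"
  proof (rule IH)
    show "R \<subset> V" using S by (auto simp: R_def)
    show "sun_bounded E R" unfolding sun_bounded_def
    proof (intro conjI allI impI)
      fix X assume X: "X \<subseteq> R"
      have "sun_number E (R - X) + 2 * card S = sun_number E (V - (S \<union> X))"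
        using rest_bound[OF fin(1), of X S] X S(3) by (simp add: R_def I_def)
      also have "\<dots> \<le> 2 * card (S \<union> X)" by (rule sun_boundedD[OF sun_bounded]) (use S X in \<open>auto simp: R_def\<close>)
      also have "\<dots> \<le> 2 * (card S + card X)" using card_Un_le mult_le_mono2 by blast
      finally show "sun_number E (R - X) \<le> 2 * card X" by simp
    qed (use fin in \<open>simp add: R_def\<close>)
  qed
  have U: "(\<Union>s\<in>S. insert s (g (s, False) \<union> g (s, True))) = S \<union> \<Union>I"
  proof -
    have "\<Union>I = (\<Union>p\<in>S \<times> (UNIV::bool set). g p)" using g(1) by (auto simp: bij_betw_def)
    also have "\<dots> = (\<Union>s\<in>S. g (s, False) \<union> g (s, True))" by (auto simp: UNIV_bool)
    finally show ?thesis by auto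
  qed
  have "path_cover E ((S \<union> \<Union>I) \<union> R)" by (rule path_cover_Un[OF 1[unfolded U] 2]) (auto simp: R_def)
  moreover have "(S \<union> \<Union>I) \<union> R = V" using S suns_props(1)[OF _ fin(1)] by (auto simp: R_def I_def)
  ultimately show ?thesis by simp
qed

section \<open>Leaves and their neighbours\<close>

lemma suns_sing: "x \<in> W \<Longrightarrow> (\<And>y. y \<in> W \<Longrightarrow> \<not> E x y) \<Longrightarrow> {x} \<in> suns E W"
  by (auto simp: suns_def comps_def conn_set_sing sun_set_sing no_edge_def)

text \<open>Two leaves at \<open>w\<close> would be two suns \<open>K_1\<close> after deleting
  \<open>w\<close>, against the strict bound for \<open>{w}\<close>.\<close>

lemma leaf_unique:
  assumes "strictly_sun_bounded E V" "leaf_of E V l w" "leaf_of E V l' w" shows "l = l'"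
proof (rule ccontr)
  assume ne: "l \<noteq> l'"
  have "{{l}, {l'}} \<subseteq> suns E (V - {w})"
    using assms(2,3) irr by (auto intro!: suns_sing simp: leaf_of_def)
  moreover have "finite V" using assms(1) by (simp add: strictly_sun_bounded_def)
  ultimately have "card {{l}, {l'}} \<le> sun_number E (V - {w})"
    unfolding sun_number_def by (intro card_mono finite_suns) auto
  moreover have "sun_number E (V - {w}) < 2 * card {w}" using strictly_sun_boundedD[OF assms(1), of "{w}"] assms(2) by (simp add: leaf_of_def)
  ultimately show False using ne by simp
qed

text \<open>Otherwise \<open>l\<close> and \<open>w\<close> are leaves of each other, and
  connectedness makes \<open>V\<close> the sun \<open>K_2\<close>.\<close>

lemma leaf_not_owner:
  assumes "strictly_sun_bounded E V" "leaf_of E V l w" "leaf_of E V l' l" shows False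
proof -
  have l': "l' = w" using assms(2,3) sym by (auto simp: leaf_of_def)
  have ne: "l \<noteq> w" using assms(2) irr by (auto simp: leaf_of_def)
  have "{l, w} = V"
    by (rule conn_setD[of E]) (use assms l' in \<open>auto simp: strictly_sun_bounded_def leaf_of_def no_edge_def\<close>)
  hence "corona E V {w} (\<lambda>_. l)" using assms(2) ne irr by (auto simp: corona_def leaf_of_def)
  moreover have "fc_set E {w}" by (simp add: fc_set_def)
  ultimately show False using assms(1) by (auto simp: strictly_sun_bounded_def sun_set_def)
qed

lemma exists_plain_vertex:
  assumes st: "strictly_sun_bounded E V" and IH: "\<And>W. W \<subset> V \<Longrightarrow> sun_bounded E W \<Longrightarrow> path_cover E W"
  shows "\<exists>y\<in>V. (\<nexists>w. leaf_of E V y w) \<and> (\<nexists>l. leaf_of E V l y)"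
proof (rule ccontr)
  assume "\<not> ?thesis"
  hence all: "(\<exists>w. leaf_of E V x w) \<or> (\<exists>l. leaf_of E V l x)" if "x \<in> V" for x using that by blast
  define H where "H = {w. \<exists>l. leaf_of E V l w}"
  define u where "u w = (SOME l. leaf_of E V l w)" for w
  have u: "leaf_of E V (u w) w" if "w \<in> H" for w
    using that unfolding H_def u_def by (auto intro: someI)
  have fin: "finite V" using st by (simp add: strictly_sun_bounded_def)
  have HV: "H \<subseteq> V" by (auto simp: H_def leaf_of_def)
  have notH: "u w \<notin> H" if "w \<in> H" for w
    using leaf_not_owner[OF st u[OF that]] by (auto simp: H_def)
  have co: "corona E V H u" unfolding corona_def
  proof (intro conjI)
    show "inj_on u H"
    proof (rule inj_onI)
      fix a b assume "a \<in> H" "b \<in> H" "u a = u b"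
      thus "a = b" using u[of a] u[of b] by (auto simp: leaf_of_def)
    qed
    show "u ` H = V - H"
    proof (intro equalityI subsetI)
      fix x assume "x \<in> u ` H" thus "x \<in> V - H" using u notH by (auto simp: leaf_of_def)
    next
      fix x assume x: "x \<in> V - H"
      then obtain w where w: "leaf_of E V x w" using all[of x] by (auto simp: H_def)
      hence "w \<in> H" by (auto simp: H_def)
      hence "x = u w" using leaf_unique[OF st w u] by simp
      thus "x \<in> u ` H" using \<open>w \<in> H\<close> by simp
    qed
    show "\<forall>v\<in>H. \<forall>x\<in>V. E (u v) x = (x = v)" using u by (auto simp: leaf_of_def)
  qed (rule HV)
  have "\<not> fc_set E H" using co st by (auto simp: strictly_sun_bounded_def sun_set_def)
  then obtain v where v: "v \<in> H" "\<not> has_pm E (H - {v})" by (auto simp: fc_set_def)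
  have uv: "u v \<in> V" "v \<in> V" "u v \<noteq> v" using u[OF v(1)] irr by (auto simp: leaf_of_def)
  define W where "W = V - {v, u v}"
  have "corona E W (H - {v}) u"
    using co v uv notH corona_inj[OF co] unfolding corona_def W_def
    by (auto simp: inj_on_def)
  hence "\<not> path_cover E W" using path_cover_corona_pm v(2) by blast
  moreover have "W \<subset> V" using uv by (auto simp: W_def)
  ultimately have "\<not> sun_bounded E W" using IH by blast
  then obtain X where X: "X \<subseteq> W" "2 * card X < sun_number E (W - X)" using fin by (auto simp: sun_bounded_def W_def not_le)
  \<comment> \<open>Deleting \<open>v\<close> as well isolates \<open>u v\<close>, which is one more
    sun. At least \<open>2 * card X + 2\<close> suns then survive the deletion of
    \<open>insert v X\<close>, against the strict bound.\<close>
  have "sun_number E ((W - X) \<union> {u v}) = sun_number E (W - X) + sun_number E {u v}"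
  proof (rule sun_number_split)
    show "no_edge E (W - X) {u v}" using u[OF v(1)] sym unfolding no_edge_def leaf_of_def W_def by blast
  qed (use fin in \<open>auto simp: W_def\<close>)
  moreover have "(W - X) \<union> {u v} = V - insert v X" using uv X by (auto simp: W_def)
  ultimately have "sun_number E (V - insert v X) = sun_number E (W - X) + 1" by (simp add: sun_number_sing)
  moreover have "sun_number E (V - insert v X) < 2 * card (insert v X)"
    by (rule strictly_sun_boundedD[OF st]) (use X uv in \<open>auto simp: W_def\<close>)
  moreover have "card (insert v X) = Suc (card X)"
    using X fin by (intro card_insert_disjoint) (auto simp: W_def intro: finite_subset)
  ultimately show False using X(2) by simp
qed

section \<open>Cut vertices\<close>

lemma conn_insert:
  assumes "conn_set E V" "y \<in> V" "Z \<subseteq> V - {y}" "no_edge E Z (V - {y} - Z)"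
  shows "conn_set E (insert y Z)"
  unfolding conn_set_def
proof (intro conjI allI impI)
  fix B assume B: "B \<subseteq> insert y Z \<and> B \<noteq> {} \<and> no_edge E B (insert y Z - B)"
  show "B = insert y Z"
  proof (cases "y \<in> B")
    case False
    have "B = V"
    proof (rule conn_setD[OF assms(1)])
      show "no_edge E B (V - B)"
        unfolding no_edge_def
      proof (intro ballI)
        fix a b assume a: "a \<in> B" and b: "b \<in> V - B"
        have "a \<in> Z" using a B False by auto
        thus "\<not> E a b"
          using a b B assms(4) by (cases "b \<in> insert y Z") (auto simp: no_edge_def)
      qed
    qed (use B False assms in auto)
    thus ?thesis using False assms by auto
  next
    case True
    show ?thesis
    proof (rule ccontr)
      assume "B \<noteq> insert y Z"
      \<comment> \<open>The complement of \<open>B\<close> in \<open>insert y Z\<close> avoids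
        \<open>y\<close>, and by symmetry no edge leaves it, so it is closed in \<open>V\<close> as
        in the first case.\<close>
      have nb: "no_edge E (insert y Z - B) B" using B no_edge_sym by blast
      have "insert y Z - B = V"
      proof (rule conn_setD[OF assms(1)])
        show "no_edge E (insert y Z - B) (V - (insert y Z - B))"
          unfolding no_edge_def
        proof (intro ballI)
          fix a b assume a: "a \<in> insert y Z - B" and b: "b \<in> V - (insert y Z - B)"
          show "\<not> E a b"
            using a b nb True assms(4) by (cases "b \<in> B") (auto simp: no_edge_def)
        qed
      qed (use assms B \<open>B \<noteq> insert y Z\<close> in auto)
      thus False using True assms by auto
    qed
  qed
qed simp

text \<open>If \<open>y\<close> were a base vertex, its pendant would be a leaf of \<open>V\<close>
  at \<open>y\<close>, because no edge leaves \<open>Z\<close> except towards \<open>y\<close>. So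
  \<open>y\<close> is a pendant \<open>u v\<close>, and \<open>H = {v}\<close> would make
  \<open>v\<close> a leaf at \<open>y\<close>. The second conclusion serves to link two such parts
  by a path through \<open>y\<close>.\<close>

lemma cut_part_sun:
  assumes st: "strictly_sun_bounded E V" and y: "y \<in> V" "\<nexists>l. leaf_of E V l y"
    and Z: "Z \<subseteq> V - {y}" "Z \<noteq> {}" "no_edge E Z (V - {y} - Z)" and sun: "sun_set E (insert y Z)"
  shows "path_cover E Z" "\<exists>v\<in>Z. E y v \<and> path_cover E (Z - {v})"
proof -
  have finZ: "finite (insert y Z)" using st Z finite_subset by (auto simp: strictly_sun_bounded_def)
  have yZ: "y \<notin> Z" using Z by auto
  have leaf: False if "l \<in> Z" "\<And>x. x \<in> insert y Z \<Longrightarrow> E l x \<longleftrightarrow> x = y" for l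
  proof -
    have "leaf_of E V l y" unfolding leaf_of_def
    proof (intro conjI ballI)
      fix x assume x: "x \<in> V"
      show "E l x = (x = y)"
      proof (cases "x \<in> insert y Z")
        case False
        hence "\<not> E l x" using x that(1) Z(3) by (auto simp: no_edge_def)
        thus ?thesis using False by auto
      qed (use that in auto)
    qed (use that Z y in auto)
    thus False using y by auto
  qed
  have "\<nexists>x. insert y Z = {x}" using Z(2) yZ by auto
  then obtain H u where H: "corona E (insert y Z) H u" "fc_set E H" using sun by (auto simp: sun_set_def)
  have "y \<notin> H"
  proof
    assume yH: "y \<in> H"
    show False
    proof (rule leaf[of "u y"])
      show "u y \<in> Z" using corona_mem[OF H(1) yH] corona_disj[OF H(1) yH yH] by auto
      show "E (u y) x = (x = y)" if "x \<in> insert y Z" for x using H(1) yH that unfolding corona_def by blast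
    qed
  qed
  then obtain v where v: "v \<in> H" "y = u v" using corona_cases[OF H(1), of y] by auto
  have vZ: "v \<in> Z" using v corona_mem[OF H(1) v(1)] corona_disj[OF H(1) v(1) v(1)] by auto
  have yv: "E y v" using corona_edge[OF H(1) v(1)] v sym by simp
  have Hne: "H \<noteq> {v}"
  proof
    assume "H = {v}"
    hence "insert y Z = {v, y}" using corona_split[OF H(1), of "{}"] v by auto
    hence "Z = {v}" using yZ vZ by auto
    thus False using leaf[of v] yv sym irr by auto
  qed
  show "path_cover E Z" using corona_minus_leaf[OF finZ H v(1) Hne] v yZ by simp
  have "path_cover E ((H - {v}) \<union> u ` (H - {v}))"
    by (rule corona_sub_path_cover[OF H(1) finZ]) (use H v in \<open>auto simp: fc_set_def\<close>)
  moreover have "Z - {v} = (H - {v}) \<union> u ` (H - {v})"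
    using corona_split[OF H(1), of "{v}"] v yZ by auto
  ultimately have "path_cover E (Z - {v})" by simp
  thus "\<exists>v\<in>Z. E y v \<and> path_cover E (Z - {v})" using vZ yv by (intro bexI[of _ v] conjI)
qed

text \<open>If \<open>y\<close> is deleted, suns on the other side only add to the count for
  \<open>V\<close>. If not, every sun except possibly the component of \<open>y\<close> is still a
  sun of \<open>V - X\<close>, and the strict bound pays for that one. For \<open>X = {}\<close> the
  set is connected and not a sun.\<close>

lemma cut_part_not_sun:
  assumes st: "strictly_sun_bounded E V" and y: "y \<in> V"
    and Z: "Z \<subset> V - {y}" "Z \<noteq> {}" "no_edge E Z (V - {y} - Z)" and ns: "\<not> sun_set E (insert y Z)"
    and IH: "\<And>W. W \<subset> V \<Longrightarrow> sun_bounded E W \<Longrightarrow> path_cover E W"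
  shows "path_cover E (insert y Z)"
proof (rule IH)
  show "insert y Z \<subset> V" using Z y by auto
  have fin: "finite V" "finite Z" using st Z finite_subset[of Z V] by (auto simp: strictly_sun_bounded_def)
  have c: "conn_set E (insert y Z)" using st Z y by (intro conn_insert[of V]) (auto simp: strictly_sun_bounded_def)
  have yZ: "y \<notin> Z" using Z by auto
  show "sun_bounded E (insert y Z)" unfolding sun_bounded_def
  proof (intro conjI allI impI)
    fix X assume X: "X \<subseteq> insert y Z"
    have XV: "X \<subseteq> V" using X Z y by auto
    show "sun_number E (insert y Z - X) \<le> 2 * card X"
    proof (cases "y \<in> X")
      case True
      have "sun_number E ((Z - X) \<union> (V - {y} - Z)) = sun_number E (Z - X) + sun_number E (V - {y} - Z)"
        by (rule sun_number_split) (use Z fin in \<open>auto intro: no_edge_mono\<close>)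
      moreover have "(Z - X) \<union> (V - {y} - Z) = V - X" using X True Z by auto
      moreover have "sun_number E (V - X) < 2 * card X" using strictly_sun_boundedD[OF st XV] True by blast
      moreover have "insert y Z - X = Z - X" using True by auto
      ultimately show ?thesis by simp
    next
      case False
      show ?thesis
      proof (cases "X = {}")
        case True
        thus ?thesis using c ns by (simp add: sun_number_conn)
      next
        case Xne: False
        obtain K where K: "K \<in> comps E (insert y Z - X)" "y \<in> K"
          using in_comp[of "insert y Z - X" y] fin False by auto
        have "suns E (insert y Z - X) - {K} \<subseteq> suns E (V - X)"
        proof
          fix C assume C: "C \<in> suns E (insert y Z - X) - {K}"
          hence cc: "C \<in> comps E (insert y Z - X)" "sun_set E C" by (auto simp: suns_def)
          have yC: "y \<notin> C" using comps_disj[OF cc(1) K(1)] K(2) C by auto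
          have "C \<subseteq> Z - X" using comps_subset[OF cc(1)] yC by auto
          moreover have "no_edge E C (V - X - C)"
            unfolding no_edge_def
          proof (intro ballI)
            fix a b assume a: "a \<in> C" and b: "b \<in> V - X - C"
            show "\<not> E a b"
            proof (cases "b \<in> insert y Z")
              case True
              thus ?thesis using a b cc(1) by (auto simp: comps_def no_edge_def)
            next
              case False
              thus ?thesis using a b Z(3) \<open>C \<subseteq> Z - X\<close> by (auto simp: no_edge_def)
            qed
          qed
          ultimately show "C \<in> suns E (V - X)" using cc Z by (auto simp: suns_def comps_def)
        qed
        hence "card (suns E (insert y Z - X) - {K}) \<le> sun_number E (V - X)"
          unfolding sun_number_def by (intro card_mono finite_suns) (use fin in auto)
        moreover have "card (suns E (insert y Z - X)) \<le> card (suns E (insert y Z - X) - {K}) + 1"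
          by (auto simp: card_Diff_singleton_if)
        moreover have "sun_number E (V - X) < 2 * card X" using strictly_sun_boundedD[OF st XV Xne] .
        ultimately show ?thesis by (simp add: sun_number_def)
      qed
    qed
  qed (use fin in auto)
qed

lemma path_cover_cut_vertex:
  assumes st: "strictly_sun_bounded E V" and y: "y \<in> V" "\<nexists>l. leaf_of E V l y" and V: "V \<noteq> {y}"
    and nc: "\<not> conn_set E (V - {y})"
    and IH: "\<And>W. W \<subset> V \<Longrightarrow> sun_bounded E W \<Longrightarrow> path_cover E W"
  shows "path_cover E V"
proof -
  have fin: "finite V" using st by (simp add: strictly_sun_bounded_def)
  obtain R where R: "R \<subseteq> V - {y}" "R \<noteq> {}" "no_edge E R (V - {y} - R)" "R \<noteq> V - {y}"
    using nc V y by (auto simp: conn_set_def)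
  define T where "T = V - {y} - R"
  have T: "T \<subseteq> V - {y}" "T \<noteq> {}" "no_edge E T (V - {y} - T)" "T \<noteq> V - {y}"
  proof -
    have "V - {y} - T = R" using R by (auto simp: T_def)
    thus "no_edge E T (V - {y} - T)" using no_edge_sym[OF R(3)] by (simp add: T_def)
  qed (use R in \<open>auto simp: T_def\<close>)
  have VV: "V = insert y (R \<union> T)" "R \<inter> T = {}" "y \<notin> R" "y \<notin> T" using R y by (auto simp: T_def)
  have finRT: "finite R" "finite T" using fin VV(1) by auto
  have V1: "path_cover E R \<Longrightarrow> path_cover E (insert y T) \<Longrightarrow> path_cover E V"
    using path_cover_Un[of E R "insert y T"] VV by auto
  have V2: "path_cover E T \<Longrightarrow> path_cover E (insert y R) \<Longrightarrow> path_cover E V"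
    using path_cover_Un[of E T "insert y R"] VV by (auto simp: Un_commute)
  \<comment> \<open>If \<open>X\<close> and \<open>X'\<close> violated the bounds of
    \<open>R\<close> and \<open>T\<close>, deleting both together with \<open>y\<close> would leave
    at least \<open>2 * (card X + card X' + 1)\<close> suns, against strictness. Hence one side can
    be covered alone, while \<open>y\<close> goes with the other.\<close>
  have okRT: "sun_bounded E R \<or> sun_bounded E T"
  proof (rule ccontr)
    assume "\<not> (sun_bounded E R \<or> sun_bounded E T)"
    then obtain X X' where X: "X \<subseteq> R" "2 * card X < sun_number E (R - X)" "X' \<subseteq> T" "2 * card X' < sun_number E (T - X')"
      using finRT by (auto simp: sun_bounded_def not_le)
    have "sun_number E ((R - X) \<union> (T - X')) = sun_number E (R - X) + sun_number E (T - X')"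
    proof (rule sun_number_split)
      show "no_edge E (R - X) (T - X')" by (rule no_edge_mono[OF R(3)]) (auto simp: T_def)
    qed (use VV finRT in auto)
    moreover have "(R - X) \<union> (T - X') = V - insert y (X \<union> X')" using VV X by auto
    moreover have "sun_number E (V - insert y (X \<union> X')) < 2 * card (insert y (X \<union> X'))"
      by (rule strictly_sun_boundedD[OF st]) (use VV X in auto)
    moreover have "card (insert y (X \<union> X')) \<le> Suc (card X + card X')"
      using card_Un_le[of X X'] by (metis card_insert_le_m1 diff_Suc_1 zero_less_Suc)
    ultimately show False using X by simp
  qed
  have RV: "R \<subset> V" "T \<subset> V" using VV R T by auto
  have nsun: "sun_set E (insert y Z) \<or> path_cover E (insert y Z)" if "Z = R \<or> Z = T" for Z
    using that cut_part_not_sun[OF st y(1) _ _ _ _ IH, of Z] R T by auto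
  note sR = cut_part_sun[OF st y R(1-3)] and sT = cut_part_sun[OF st y T(1-3)]
  show ?thesis
  proof (cases "sun_set E (insert y R)")
    case True
    show ?thesis
    proof (cases "sun_set E (insert y T)")
      case T2: True
      obtain v where v: "v \<in> R" "E y v" "path_cover E (R - {v})" using sR(2)[OF True] by auto
      obtain w where w: "w \<in> T" "E y w" "path_cover E (T - {w})" using sT(2)[OF T2] by auto
      have "path_cover E (set [v, y, w])"
        by (rule path_cover_path) (use v w VV sym in \<open>auto simp: simple_path_def\<close>)
      hence "path_cover E (set [v, y, w] \<union> ((R - {v}) \<union> (T - {w})))"
        by (intro path_cover_Un v w) (use VV v w in auto)
      moreover have "set [v, y, w] \<union> ((R - {v}) \<union> (T - {w})) = V" using VV v w by auto
      ultimately show ?thesis by simp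
    next
      case False
      thus ?thesis using V1 sR(1)[OF True] nsun by auto
    qed
  next
    case False
    hence cR: "path_cover E (insert y R)" using nsun by auto
    show ?thesis
    proof (cases "sun_set E (insert y T)")
      case True thus ?thesis using V2 sT(1) cR by auto
    next
      case False
      hence "path_cover E (insert y T)" using nsun by auto
      thus ?thesis using V1 V2 cR okRT IH RV by blast
    qed
  qed
qed

end

section \<open>Deletion of an edge\<close>

definition del_edge :: "('a \<Rightarrow> 'a \<Rightarrow> bool) \<Rightarrow> 'a \<Rightarrow> 'a \<Rightarrow> 'a \<Rightarrow> 'a \<Rightarrow> bool" where
  "del_edge E y z a b \<longleftrightarrow> E a b \<and> \<not> (a = y \<and> b = z) \<and> \<not> (a = z \<and> b = y)"

lemma del_edge_imp: "del_edge E y z a b \<Longrightarrow> E a b"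
  by (simp add: del_edge_def)

lemma rooted_cover_mono: "rooted_cover E k C v \<Longrightarrow> (\<And>x y. E x y \<Longrightarrow> E' x y) \<Longrightarrow> rooted_cover E' k C v"
  unfolding rooted_cover_def
proof (elim exE conjE, goal_cases)
  case (1 p)
  have "simple_path E' p" using 1 by (auto simp: simple_path_def intro: successively_mono)
  moreover have "path_cover E' (C - set p)" by (rule path_cover_mono[of E]) (use 1 in auto)
  ultimately show ?case using 1 by (intro exI[of _ p]) auto
qed

context simple_rel begin

lemma simple_rel_del_edge: "simple_rel (del_edge E y z)"
  by unfold_locales (auto simp: del_edge_def sym irr)

lemma conn_insert_vertex:
  assumes "conn_set E C" "x \<in> C" "E y x" shows "conn_set E (insert y C)"
  unfolding conn_set_def
proof (intro conjI allI impI)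
  fix B assume B: "B \<subseteq> insert y C \<and> B \<noteq> {} \<and> no_edge E B (insert y C - B)"
  show "B = insert y C"
  proof (cases "B \<inter> C = {}")
    case True
    hence "B = {y}" using B by auto
    thus ?thesis using B assms True by (auto simp: no_edge_def)
  next
    case False
    have "B \<inter> C = C"
      by (rule conn_setD[OF assms(1)]) (use False B in \<open>auto simp: no_edge_def\<close>)
    hence "x \<in> B" using assms(2) by auto
    hence "y \<in> B" using B sym[OF assms(3)] by (auto simp: no_edge_def)
    thus ?thesis using \<open>B \<inter> C = C\<close> B by auto
  qed
qed simp

text \<open>In the sun without the edge, \<open>y\<close> must be a pendant, since otherwise its
  pendant would be a leaf at \<open>y\<close> in \<open>V\<close>. Its base vertex \<open>v\<close>
  differs from the base vertex \<open>w\<close> belonging to \<open>z\<close>, because the deleted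
  edge is not a pendant edge. The edge then joins a path starting at \<open>y\<close> to the stick
  of \<open>w\<close> and \<open>u w\<close>.\<close>

lemma path_cover_sun_plus_edge:
  assumes st: "strictly_sun_bounded E V" and y: "y \<in> V" "\<nexists>w. leaf_of E V y w" "\<nexists>l. leaf_of E V l y"
    and z: "z \<in> V" "E y z" and sun: "sun_set (del_edge E y z) V"
  shows "path_cover E V"
proof -
  define E' where "E' = del_edge E y z"
  interpret E': simple_rel E' unfolding E'_def by (rule simple_rel_del_edge)
  have yz: "y \<noteq> z" using z(2) irr by auto
  have fin: "finite V" using st by (simp add: strictly_sun_bounded_def)
  have "\<nexists>x. V = {x}" using yz y(1) z(1) by auto
  then obtain H u where H: "corona E' V H u" "fc_set E' H" using sun by (auto simp: sun_set_def E'_def)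
  have leafE: "E' (u v) x \<longleftrightarrow> x = v" if "v \<in> H" "x \<in> V" for v x
    using H(1) that unfolding corona_def by blast
  have "y \<notin> H"
  proof
    assume yH: "y \<in> H"
    have ne: "u y \<noteq> y" using E'.corona_disj[OF H(1) yH yH] .
    have "u y \<noteq> z" using leafE[OF yH y(1)] by (auto simp: E'_def del_edge_def)
    hence "leaf_of E V (u y) y"
      using leafE[OF yH] ne E'.corona_mem[OF H(1) yH] y(1)
      unfolding leaf_of_def E'_def del_edge_def by metis
    thus False using y(3) by auto
  qed
  then obtain v where v: "v \<in> H" "y = u v" using E'.corona_cases[OF H(1) y(1)] by auto
  obtain w where w: "w \<in> H" "z = w \<or> z = u w" using E'.corona_cases[OF H(1) z(1)] by auto
  have vw: "v \<noteq> w"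
  proof
    assume "v = w"
    hence "z = v" using w(2) v(2) yz by auto
    moreover have "\<not> E' y z" by (simp add: E'_def del_edge_def)
    ultimately show False using leafE[OF v(1) z(1)] v(2) by auto
  qed
  have "rooted_cover E' 3 (V - {w, u w}) y" using E'.corona_stk3[OF fin H v(1) w(1) vw] v by simp
  hence 1: "rooted_cover E 3 (V - {w, u w}) y" by (rule rooted_cover_mono) (simp add: E'_def del_edge_def)
  have 2: "rooted_cover E 2 {w, u w} z"
    by (rule rooted_cover_mono[OF E'.corona_stk2[OF H(1) w]]) (simp add: E'_def del_edge_def)
  have "path_cover E ((V - {w, u w}) \<union> {w, u w})" by (rule rooted_cover_join[OF 1 2 z(2)]) auto
  moreover have "(V - {w, u w}) \<union> {w, u w} = V" using E'.corona_mem[OF H(1) w(1)] by auto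
  ultimately show ?thesis by simp
qed

text \<open>Only the component \<open>D\<close> of \<open>y\<close> and \<open>z\<close> changes,
  and it splits into at most two components. The count rises from at most
  \<open>2 * card S - 1\<close> to at least \<open>2 * card S + 1\<close>, so \<open>D\<close>
  contributes 0 before and exactly 2 afterwards.\<close>

lemma split_by_edge:
  assumes fin: "finite V" and S: "S \<subseteq> V" and yz: "E y z" "y \<in> V" "z \<in> V"
    and lt: "sun_number E (V - S) < 2 * card S" and gt: "2 * card S < sun_number (del_edge E y z) (V - S)"
  obtains A B where "A \<inter> B = {}" "y \<in> A" "z \<in> B" "A \<union> B \<in> comps E (V - S)" "\<not> sun_set E (A \<union> B)"
    "sun_set E A" "sun_set E B" "Suc (sun_number E (V - S)) = 2 * card S"
    "\<forall>a\<in>A. \<forall>b\<in>B. E a b \<longrightarrow> a = y \<and> b = z"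
proof -
  define E' where "E' = del_edge E y z"
  interpret E': simple_rel E' unfolding E'_def by (rule simple_rel_del_edge)
  define W where "W = V - S"
  have finW: "finite W" using fin by (simp add: W_def)
  have in_W: "y \<in> W \<and> z \<in> W"
  proof (rule ccontr)
    assume "\<not> (y \<in> W \<and> z \<in> W)"
    hence "sun_number E' W = sun_number E W" by (intro sun_number_cong) (auto simp: E'_def del_edge_def)
    thus False using lt gt by (simp add: W_def E'_def)
  qed
  obtain D where D: "D \<in> comps E W" "y \<in> D" using in_comp[OF finW] in_W by auto
  have DW: "D \<subseteq> W" "no_edge E D (W - D)" "conn_set E D" using D by (auto simp: comps_def)
  have zD: "z \<in> D" using DW(2) D(2) yz(1) in_W by (auto simp: no_edge_def)
  have finD: "finite D" using DW finW finite_subset by auto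
  have W: "D \<union> (W - D) = W" using DW by auto
  have s1: "sun_number E W = sun_number E D + sun_number E (W - D)"
    using sun_number_split[OF DW(2)] finD finW W by auto
  have "no_edge E' D (W - D)" using DW(2) by (auto simp: no_edge_def E'_def del_edge_def)
  hence s2: "sun_number E' W = sun_number E' D + sun_number E' (W - D)"
    using E'.sun_number_split[of D "W - D"] finD finW W by auto
  have s3: "sun_number E' (W - D) = sun_number E (W - D)"
    by (rule sun_number_cong) (use D(2) zD in \<open>auto simp: E'_def del_edge_def\<close>)
  obtain A where A: "A \<in> comps E' D" "y \<in> A" using E'.in_comp[OF finD D(2)] by auto
  obtain B where B: "B \<in> comps E' D" "z \<in> B" using E'.in_comp[OF finD zD] by auto
  have AB: "A \<union> B = D"
  proof (rule conn_setD[OF DW(3)])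
    show "A \<union> B \<subseteq> D" using comps_subset[OF A(1)] comps_subset[OF B(1)] by auto
    show "no_edge E (A \<union> B) (D - (A \<union> B))" unfolding no_edge_def
    proof (intro ballI)
      fix a b assume a: "a \<in> A \<union> B" and b: "b \<in> D - (A \<union> B)"
      have "\<not> E' a b" using a b A(1) B(1) by (auto simp: comps_def no_edge_def)
      moreover have "b \<noteq> y" "b \<noteq> z" using b A B by auto
      ultimately show "\<not> E a b" by (auto simp: E'_def del_edge_def)
    qed
  qed (use A in auto)
  have cAB: "C = A \<or> C = B" if C: "C \<in> comps E' D" for C
  proof -
    obtain x where "x \<in> C" using comps_ne[OF C] by auto
    hence "x \<in> A \<or> x \<in> B" using AB comps_subset[OF C] by auto
    thus ?thesis using comps_disj[OF C A(1)] comps_disj[OF C B(1)] \<open>x \<in> C\<close> by blast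
  qed
  have sub: "suns E' D \<subseteq> {A, B}" using cAB by (auto simp: suns_def)
  have "card (suns E' D) \<le> card {A, B}" by (rule card_mono[OF _ sub]) simp
  also have "\<dots> \<le> 2" by (simp add: card_insert_if)
  finally have le2: "sun_number E' D \<le> 2" by (simp add: sun_number_def)
  have two: "sun_number E' D = 2" "sun_number E D = 0" "Suc (sun_number E W) = 2 * card S"
    using s1 s2 s3 le2 lt gt unfolding W_def[symmetric] E'_def[symmetric] by linarith+
  have "A \<noteq> B"
  proof
    assume "A = B"
    hence "card (suns E' D) \<le> card {A}" by (intro card_mono) (use sub in auto)
    thus False using two(1) by (simp add: sun_number_def)
  qed
  have "suns E' D = {A, B}"
    by (rule card_subset_eq[OF _ sub]) (use two(1) \<open>A \<noteq> B\<close> in \<open>auto simp: sun_number_def\<close>)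
  hence sAB: "sun_set E' A" "sun_set E' B" by (auto simp: suns_def)
  have dj: "A \<inter> B = {}" using comps_disj[OF A(1) B(1)] \<open>A \<noteq> B\<close> by auto
  have nyz: "z \<notin> A" "y \<notin> B" using dj A B by auto
  have "sun_set E A" using sAB(1) sun_set_cong[of A E E'] nyz by (auto simp: E'_def del_edge_def)
  moreover have "sun_set E B" using sAB(2) sun_set_cong[of B E E'] nyz by (auto simp: E'_def del_edge_def)
  moreover have "\<not> sun_set E D" using two(2) sun_number_conn[OF DW(3)] by auto
  moreover have "\<forall>a\<in>A. \<forall>b\<in>B. E a b \<longrightarrow> a = y \<and> b = z"
  proof (intro ballI impI)
    fix a b assume ab: "a \<in> A" "b \<in> B" "E a b"
    have "\<not> E' a b" using A(1) ab dj AB by (auto simp: comps_def no_edge_def)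
    thus "a = y \<and> b = z" using ab nyz by (auto simp: E'_def del_edge_def)
  qed
  moreover have "A \<union> B \<in> comps E (V - S)" using D(1) AB by (simp add: W_def)
  moreover have "\<not> sun_set E (A \<union> B)" using calculation(3) AB by simp
  ultimately show thesis using dj A(2) B(2) two(3)[unfolded W_def] by (intro that[of A B])
qed

text \<open>The set \<open>Y\<close> is chosen so that attaching \<open>S\<close> at a vertex of \<open>Y\<close> avoids the bad case of \<open>sun_two_sticks\<close>; it has a
neighbour in \<open>S\<close> since \<open>y\<close> is neither a leaf, nor adjacent to a leaf, nor a cut vertex.\<close>

lemma attach_set:
  assumes fin: "finite V" and nc: "conn_set E (V - {y})"
    and y: "y \<in> V" "\<nexists>w. leaf_of E V y w" "\<nexists>l. leaf_of E V l y"
    and S: "S \<subseteq> V" and yz: "E y z" "z \<in> V"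
    and AB: "A \<inter> B = {}" "y \<in> A" "z \<in> B" "A \<union> B \<in> comps E (V - S)" "sun_set E A" "sun_set E B"
    and e: "\<forall>a\<in>A. \<forall>b\<in>B. E a b \<longrightarrow> a = y \<and> b = z"
  shows "\<exists>Y\<subseteq>A. (\<exists>s\<in>S. \<exists>d\<in>Y. E s d) \<and>
    (\<forall>Q s d. d \<in> Y \<and> E s d \<and> rooted_cover E 2 Q s \<and> Q \<inter> (A \<union> B) = {} \<longrightarrow> path_cover E (Q \<union> (A \<union> B)))"
proof -
  have that: ?thesis if "Y \<subseteq> A" "\<exists>s\<in>S. \<exists>d\<in>Y. E s d"
    "\<And>Q s d. d \<in> Y \<Longrightarrow> E s d \<Longrightarrow> rooted_cover E 2 Q s \<Longrightarrow> Q \<inter> (A \<union> B) = {} \<Longrightarrow> path_cover E (Q \<union> (A \<union> B))" for Y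
    using that by (intro exI[of _ Y]) blast
  have sub: "A \<union> B \<subseteq> V - S" "no_edge E (A \<union> B) (V - S - (A \<union> B))" using AB(4) by (auto simp: comps_def)
  have finA: "finite A" "finite B" using sub(1) fin by (auto intro: finite_subset)
  have nbr: "x \<in> A \<or> a = y \<and> x = z" if "a \<in> A" "x \<in> V" "E a x" "\<forall>s\<in>S. \<not> E s a" for a x
  proof -
    have "x \<notin> S" using that sym by auto
    hence "x \<in> A \<union> B" using sub(2) that by (auto simp: no_edge_def)
    thus ?thesis using e that by auto
  qed
  have Bz: "rooted_cover E 1 B z" using sun_rooted_cover[OF AB(6) finA(2) AB(3)] .
  \<comment> \<open>Without a neighbour in \<open>S\<close>, such an \<open>l\<close> would have
    \<open>y\<close> as its only neighbour in \<open>V\<close>, contrary to the choice of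
    \<open>y\<close>.\<close>
  have att: "\<exists>s\<in>S. \<exists>d\<in>{l}. E s d"
    if "l \<in> A" "l \<noteq> y" "\<And>x. x \<in> A \<Longrightarrow> E l x \<longleftrightarrow> x = y" for l
  proof (rule ccontr)
    assume "\<not> ?thesis"
    hence "leaf_of E V l y" unfolding leaf_of_def
      using nbr[OF that(1)] that AB(2) sub(1) y(1) by blast
    thus False using y(3) by auto
  qed
  show ?thesis
  proof (cases "\<exists>x. A = {x}")
    case True
    hence A: "A = {y}" using AB(2) by auto
    show ?thesis
    proof (rule that[of "{y}"])
      show "\<exists>s\<in>S. \<exists>d\<in>{y}. E s d"
      proof (rule ccontr)
        assume "\<not> ?thesis"
        hence "leaf_of E V y z" unfolding leaf_of_def
          using nbr[of y] A y(1) yz irr by blast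
        thus False using y(2) by auto
      qed
      fix Q s d assume q: "d \<in> {y}" "E s d" "rooted_cover E 2 Q s" "Q \<inter> (A \<union> B) = {}"
      have "rooted_cover E (Suc 1) (insert y B) y" by (rule rooted_cover_cons[OF Bz yz(1)]) (use AB in auto)
      from rooted_cover_join[OF q(3) this] have "path_cover E (Q \<union> insert y B)" using q A by auto
      thus "path_cover E (Q \<union> (A \<union> B))" using A by simp
    qed (use A in auto)
  next
    case False
    then obtain H u where H: "corona E A H u" "fc_set E H" using AB(5) by (auto simp: sun_set_def)
    have two: "path_cover E (Q \<union> (A \<union> B))"
      if "v \<in> H" "E s d" "rooted_cover E 2 Q s" "Q \<inter> (A \<union> B) = {}"
        "d = v \<and> y = u v \<or> d = u v \<and> y = v \<or> y = u v \<and> d \<in> A \<and> H \<noteq> {v}" for v Q s d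
      using sun_two_sticks[OF finA(1) H that(1) that(3) Bz that(2) yz(1) _ _ AB(1) that(5)] that(4)
      by (simp add: Int_Un_distrib Un_assoc)
    have leafE: "E (u v) x \<longleftrightarrow> x = v" if "v \<in> H" "x \<in> A" for v x
      using H(1) that unfolding corona_def by blast
    show ?thesis
    proof (cases "y \<in> H")
      case yH: True
      show ?thesis
      proof (rule that[of "{u y}"])
        show "\<exists>s\<in>S. \<exists>d\<in>{u y}. E s d"
          by (rule att) (use corona_mem[OF H(1) yH] corona_disj[OF H(1) yH yH] leafE[OF yH] in auto)
        show "{u y} \<subseteq> A" using corona_mem[OF H(1) yH] by auto
      qed (use two[OF yH] in auto)
    next
      case yH: False
      then obtain v where v: "v \<in> H" "y = u v" using corona_cases[OF H(1) AB(2)] by auto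
      have vA: "v \<in> A" "v \<noteq> y" using corona_mem[OF H(1) v(1)] corona_disj[OF H(1) v(1) v(1)] v(2) by auto
      show ?thesis
      proof (cases "H = {v}")
        case True
        have A: "A = {v, y}" using corona_split[OF H(1), of "{}"] v True by auto
        show ?thesis
        proof (rule that[of "{v}"])
          show "\<exists>s\<in>S. \<exists>d\<in>{v}. E s d"
            by (rule att) (use vA A corona_edge[OF H(1) v(1)] v(2) irr in auto)
        qed (use two[OF v(1)] vA v(2) in auto)
      next
        case False
        show ?thesis
        proof (rule that[of A])
          show "\<exists>s\<in>S. \<exists>d\<in>A. E s d"
          proof (rule ccontr)
            \<comment> \<open>This is where \<open>y\<close> not being a cut vertex enters: with no
              edge from \<open>S\<close> to \<open>A\<close>, the set \<open>A - {y}\<close> would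
              be closed in \<open>V - {y}\<close>, although it misses \<open>z\<close>.\<close>
            assume no: "\<not> ?thesis"
            have "A - {y} = V - {y}"
            proof (rule conn_setD[OF nc])
              show "no_edge E (A - {y}) (V - {y} - (A - {y}))"
                unfolding no_edge_def using nbr no by blast
            qed (use vA sub(1) in auto)
            moreover have "z \<in> V - {y}" "z \<notin> A" using yz irr AB by auto
            ultimately show False by auto
          qed
          fix Q s d assume "d \<in> A" "E s d" "rooted_cover E 2 Q s" "Q \<inter> (A \<union> B) = {}"
          thus "path_cover E (Q \<union> (A \<union> B))" using two[OF v(1)] v(2) False by blast
        qed simp
      qed
    qed
  qed
qed

text \<open>For the genuine suns in \<open>J\<close> Hall's condition holds with one to spare by
  strictness, which pays for the extra item \<open>Y\<close>. If \<open>J\<close> contains no sun, a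
  neighbour of \<open>Y\<close> in \<open>S\<close> suffices.\<close>

lemma hall_extra:
  assumes st: "strictly_sun_bounded E V" and S: "S \<subseteq> V" and c: "Suc (sun_number E (V - S)) = 2 * card S"
    and Y: "\<exists>s\<in>S. \<exists>d\<in>Y. E s d" "Y \<notin> suns E (V - S)"
  shows "\<exists>g. bij_betw g (S \<times> (UNIV::bool set)) (insert Y (suns E (V - S))) \<and>
     (\<forall>s\<in>S. \<forall>b. \<exists>c\<in>g (s, b). E s c)"
proof (rule hall_two)
  have fin: "finite V" using st by (simp add: strictly_sun_bounded_def)
  show finS: "finite S" using finite_subset[OF S fin] .
  have finI: "finite (suns E (V - S))" using finite_suns fin by auto
  thus "finite (insert Y (suns E (V - S)))" by simp
  show "card (insert Y (suns E (V - S))) = 2 * card S" using c Y(2) finI by (simp add: sun_number_def)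
  fix J assume J: "J \<subseteq> insert Y (suns E (V - S))"
  define N where "N K = {s\<in>S. \<exists>C\<in>K. \<exists>c\<in>C. E s c}" for K
  have finN: "finite (N K)" for K using finS by (simp add: N_def)
  define J0 where "J0 = J - {Y}"
  have J0: "J0 \<subseteq> suns E (V - S)" using J by (auto simp: J0_def)
  have "card J \<le> 2 * card (N J)"
  proof (cases "J0 = {}")
    case True
    show ?thesis
    proof (cases "Y \<in> J")
      case True
      hence "J = {Y}" using \<open>J0 = {}\<close> by (auto simp: J0_def)
      moreover have "N {Y} \<noteq> {}" using Y(1) by (auto simp: N_def)
      ultimately show ?thesis using finN[of "{Y}"] by (simp add: Suc_le_eq card_gt_0_iff)
    next
      case False
      thus ?thesis using \<open>J0 = {}\<close> by (auto simp: J0_def)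
    qed
  next
    case False
    have le: "card J0 \<le> sun_number E (V - N J0)"
      using sun_neighbours[OF fin S J0] by (simp add: N_def)
    have "card J0 \<noteq> 0" using False finite_subset[OF J0 finI] by simp
    \<comment> \<open>The strict bound concerns nonempty deletions only. If the suns of
      \<open>J0\<close> had no neighbour in \<open>S\<close>, they would be suns of
      \<open>V\<close>, which has none.\<close>
    moreover have "sun_number E V = 0" using sun_number_conn[of E V] st by (simp add: strictly_sun_bounded_def)
    ultimately have "N J0 \<noteq> {}" using le by auto
    hence "sun_number E (V - N J0) < 2 * card (N J0)"
      by (intro strictly_sun_boundedD[OF st]) (use S in \<open>auto simp: N_def\<close>)
    moreover have "card (N J0) \<le> card (N J)"
      by (rule card_mono[OF finN]) (auto simp: N_def J0_def)
    moreover have "card J \<le> Suc (card J0)"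
      by (auto simp: J0_def card_Diff_singleton_if)
    ultimately show ?thesis using le by simp
  qed
  thus "card J \<le> 2 * card {s\<in>S. \<exists>C\<in>J. \<exists>c\<in>C. E s c}" by (simp add: N_def)
qed

text \<open>The vertex \<open>s0\<close> that is assigned \<open>Y\<close> gets only one genuine sun
  \<open>C1\<close>; together they form a stick of order at least 2, which the hypothesis on
  \<open>Y\<close> attaches to \<open>D\<close>. Every other vertex of \<open>S\<close> gets two
  suns as in the tight case, and minimality covers the rest.\<close>

lemma path_cover_near_tight:
  assumes st: "strictly_sun_bounded E V" and S: "S \<subseteq> V" "S \<noteq> {}" and c: "Suc (sun_number E (V - S)) = 2 * card S"
    and D: "D \<in> comps E (V - S)" "\<not> sun_set E D"
    and Y: "Y \<subseteq> D" "\<exists>s\<in>S. \<exists>d\<in>Y. E s d"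
      "\<And>Q s d. d \<in> Y \<Longrightarrow> E s d \<Longrightarrow> rooted_cover E 2 Q s \<Longrightarrow> Q \<inter> D = {} \<Longrightarrow> path_cover E (Q \<union> D)"
    and IH: "\<And>W. W \<subset> V \<Longrightarrow> sun_bounded E W \<Longrightarrow> path_cover E W"
  shows "path_cover E V"
proof -
  have fin: "finite V" using st by (simp add: strictly_sun_bounded_def)
  define I where "I = suns E (V - S)"
  have finS: "finite S" using finite_subset[OF S(1) fin] .
  have DV: "D \<subseteq> V - S" using comps_subset[OF D(1)] .
  have DI: "D \<inter> C = {}" if "C \<in> I" for C
    using that comps_disj[of C E "V - S" D] D by (auto simp: I_def suns_def)
  have YI: "Y \<notin> I" using DI[of Y] Y(1,2) by auto
  obtain g where g: "bij_betw g (S \<times> (UNIV::bool set)) (insert Y I)" "\<forall>s\<in>S. \<forall>b. \<exists>c\<in>g (s, b). E s c"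
    using hall_extra[OF st S(1) c Y(2)] YI unfolding I_def by blast
  have injg: "inj_on g (S \<times> UNIV)" and img: "g ` (S \<times> UNIV) = insert Y I" using g(1) by (auto simp: bij_betw_def)
  \<comment> \<open>The slot \<open>(s0, b0)\<close> holds \<open>Y\<close>; by injectivity all
    other slots hold suns of \<open>V - S\<close>.\<close>
  obtain s0 b0 where s0: "s0 \<in> S" "g (s0, b0) = Y"
  proof -
    have "Y \<in> g ` (S \<times> UNIV)" using img by auto
    thus ?thesis using that by auto
  qed
  have gI: "g (s, b) \<in> I" if "s \<in> S" "(s, b) \<noteq> (s0, b0)" for s b
  proof -
    have "g (s, b) \<in> insert Y I" using img that(1) by blast
    moreover have "g (s, b) \<noteq> g (s0, b0)" using injg that s0(1) by (auto dest: inj_onD)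
    ultimately show ?thesis using s0(2) by auto
  qed
  define T where "T = S - {s0}"
  define C1 where "C1 = g (s0, \<not> b0)"
  have C1: "C1 \<in> I" using gI[OF s0(1), of "\<not> b0"] by (auto simp: C1_def)
  note C1p = suns_props[OF C1[unfolded I_def] fin]
  obtain c1 where c1: "c1 \<in> C1" "E s0 c1" using g(2) s0(1) unfolding C1_def by blast
  obtain d where d: "d \<in> Y" "E s0 d" using g(2) s0 by metis
  have "rooted_cover E (Suc 1) (insert s0 C1) s0"
    by (rule rooted_cover_cons[OF sun_rooted_cover[OF C1p(4,3) c1(1)] c1(2)]) (use C1p(2) s0(1) in auto)
  hence 1: "path_cover E (insert s0 C1 \<union> D)"
    by (intro Y(3)[OF d]) (use DI[OF C1] DV s0(1) in \<open>auto simp: numeral_2_eq_2\<close>)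
  have 2: "path_cover E (\<Union>s\<in>T. insert s (g (s, False) \<union> g (s, True)))"
  proof (rule pairs_path_cover[OF fin _ S(1)])
    show "inj_on g (T \<times> UNIV)" by (rule inj_on_subset[OF injg]) (auto simp: T_def)
    show "g (s, b) \<in> suns E (V - S)" if "s \<in> T" for s b using gI[of s b] that by (auto simp: T_def I_def)
  qed (use g(2) in \<open>auto simp: T_def\<close>)
  define P where "P = (\<Union>s\<in>T. g (s, False) \<union> g (s, True))"
  have U2: "(\<Union>s\<in>T. insert s (g (s, False) \<union> g (s, True))) = T \<union> P" by (auto simp: P_def)
  have P1: "P \<union> C1 \<union> Y = \<Union>I \<union> Y"
  proof -
    have "\<Union>I \<union> Y = (\<Union>p\<in>S \<times> (UNIV::bool set). g p)" using img by auto
    also have "\<dots> = (\<Union>s\<in>S. g (s, False) \<union> g (s, True))" by (auto simp: UNIV_bool)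
    also have "S = insert s0 T" using s0 by (auto simp: T_def)
    also have "(\<Union>s\<in>insert s0 T. g (s, False) \<union> g (s, True)) = (g (s0, False) \<union> g (s0, True)) \<union> P"
      by (auto simp: P_def)
    also have "g (s0, False) \<union> g (s0, True) = C1 \<union> Y"
      using s0(2) by (cases b0) (auto simp: C1_def)
    finally show ?thesis by auto
  qed
  have PI: "P \<subseteq> \<Union>I" using gI by (fastforce simp: P_def T_def)
  have IY: "\<Union>I \<inter> Y = {}" using DI Y(1) by blast
  have P2: "P \<union> C1 = \<Union>I" using P1 PI C1 IY by blast
  have P3: "P \<inter> C1 = {}"
  proof -
    have "g (s, b) \<inter> C1 = {}" if "s \<in> T" for s b
    proof (rule suns_disj)
      show "g (s, b) \<in> suns E (V - S)" "C1 \<in> suns E (V - S)" using gI[of s b] that C1 by (auto simp: T_def I_def)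
      show "g (s, b) \<noteq> C1" unfolding C1_def using injg that s0(1) by (auto simp: T_def dest: inj_onD)
    qed
    thus ?thesis by (auto simp: P_def)
  qed
  define R where "R = V - S - \<Union>I - D"
  have 3: "path_cover E R"
  proof (rule IH)
    show "R \<subset> V" using S by (auto simp: R_def)
    \<comment> \<open>Here only \<open>2 * card S - 1\<close> suns cancel; the missing one is
      compensated by the strict bound for \<open>S \<union> X\<close>.\<close>
    show "sun_bounded E R" unfolding sun_bounded_def
    proof (intro conjI allI impI)
      show "finite R" using fin by (simp add: R_def)
      fix X assume X: "X \<subseteq> R"
      have "sun_number E (V - S - \<Union>I - X) + sun_number E (V - S) = sun_number E (V - (S \<union> X))"
        unfolding I_def by (rule rest_bound[OF fin]) (use X in \<open>auto simp: R_def I_def\<close>)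
      moreover have "sun_number E (V - (S \<union> X)) < 2 * card (S \<union> X)"
        by (rule strictly_sun_boundedD[OF st]) (use S X in \<open>auto simp: R_def\<close>)
      moreover have "card (S \<union> X) \<le> card S + card X" by (rule card_Un_le)
      moreover have "sun_number E (D \<union> (R - X)) = sun_number E D + sun_number E (R - X)"
      proof (rule sun_number_split)
        show "no_edge E D (R - X)" using D(1) by (auto simp: comps_def R_def no_edge_def)
        show "finite D" using finite_subset[OF DV] fin by simp
      qed (use fin in \<open>auto simp: R_def\<close>)
      moreover have "D \<union> (R - X) = V - S - \<Union>I - X" using DV DI X by (auto simp: R_def)
      ultimately show "sun_number E (R - X) \<le> 2 * card X" using c by simp
    qed
  qed
  have IV: "\<Union>I \<subseteq> V - S" using comps_subset by (auto simp: I_def suns_def)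
  have ID: "\<Union>I \<inter> D = {}" using DI by blast
  have PS: "P \<inter> S = {}" and PD: "P \<inter> D = {}" using PI IV ID by blast+
  have "path_cover E ((insert s0 C1 \<union> D) \<union> (T \<union> P))"
    by (rule path_cover_Un[OF 1 2[unfolded U2]]) (use P3 C1p(2) PS PD DV s0(1) in \<open>auto simp: T_def\<close>)
  hence "path_cover E (((insert s0 C1 \<union> D) \<union> (T \<union> P)) \<union> R)"
    by (rule path_cover_Un[OF _ 3]) (use P2 s0(1) in \<open>auto simp: R_def T_def\<close>)
  moreover have "((insert s0 C1 \<union> D) \<union> (T \<union> P)) \<union> R = V"
  proof -
    have "((insert s0 C1 \<union> D) \<union> (T \<union> P)) \<union> R = insert s0 T \<union> (P \<union> C1) \<union> D \<union> R" by auto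
    also have "insert s0 T = S" using s0 by (auto simp: T_def)
    finally show ?thesis using P2 IV DV S(1) by (auto simp: R_def)
  qed
  ultimately show ?thesis by simp
qed

text \<open>If the bound survives the deletion of the edge, a cover without it will do. Otherwise a
  violating \<open>S\<close> either is empty, which makes \<open>V\<close> without the edge a sun,
  or leads to the near-tight situation.\<close>

lemma path_cover_edge_step:
  assumes st: "strictly_sun_bounded E V" and nc: "conn_set E (V - {y})"
    and y: "y \<in> V" "\<nexists>w. leaf_of E V y w" "\<nexists>l. leaf_of E V l y" and z: "z \<in> V" "E y z"
    and IH: "\<And>W. W \<subset> V \<Longrightarrow> sun_bounded E W \<Longrightarrow> path_cover E W"
    and IHe: "sun_bounded (del_edge E y z) V \<Longrightarrow> path_cover (del_edge E y z) V"
  shows "path_cover E V"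
proof (cases "sun_bounded (del_edge E y z) V")
  case True
  show ?thesis by (rule path_cover_mono[OF IHe[OF True] del_edge_imp])
next
  case False
  have fin: "finite V" using st by (simp add: strictly_sun_bounded_def)
  obtain S where S: "S \<subseteq> V" "2 * card S < sun_number (del_edge E y z) (V - S)"
    using False fin by (auto simp: sun_bounded_def not_le)
  show ?thesis
  proof (cases "S = {}")
    case True
    interpret E': simple_rel "del_edge E y z" by (rule simple_rel_del_edge)
    \<comment> \<open>As \<open>y\<close> is not a leaf it has a second neighbour, which keeps
      \<open>V\<close> connected without the edge \<open>y z\<close>. More than 0 suns then means
      that \<open>V\<close> itself is a sun.\<close>
    obtain x where x: "x \<in> V" "x \<noteq> z" "E y x" using y z unfolding leaf_of_def by blast
    have "conn_set (del_edge E y z) (V - {y})"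
      using nc conn_set_cong[of "V - {y}" E "del_edge E y z"] by (auto simp: del_edge_def)
    hence "conn_set (del_edge E y z) (insert y (V - {y}))"
      by (rule E'.conn_insert_vertex[of _ x]) (use x irr in \<open>auto simp: del_edge_def\<close>)
    hence "conn_set (del_edge E y z) V" using y(1) by (simp add: insert_absorb)
    hence "sun_set (del_edge E y z) V" using S(2) True by (simp add: sun_number_conn split: if_splits)
    thus ?thesis by (rule path_cover_sun_plus_edge[OF st y z])
  next
    case Sne: False
    obtain A B where AB: "A \<inter> B = {}" "y \<in> A" "z \<in> B" "A \<union> B \<in> comps E (V - S)" "\<not> sun_set E (A \<union> B)"
      "sun_set E A" "sun_set E B" "Suc (sun_number E (V - S)) = 2 * card S"
      "\<forall>a\<in>A. \<forall>b\<in>B. E a b \<longrightarrow> a = y \<and> b = z"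
      by (rule split_by_edge[OF fin S(1) z(2) y(1) z(1) strictly_sun_boundedD[OF st S(1) Sne] S(2)])
    obtain Y where Y: "Y \<subseteq> A" "\<exists>s\<in>S. \<exists>d\<in>Y. E s d"
      "\<forall>Q s d. d \<in> Y \<and> E s d \<and> rooted_cover E 2 Q s \<and> Q \<inter> (A \<union> B) = {} \<longrightarrow> path_cover E (Q \<union> (A \<union> B))"
      using attach_set[OF fin nc y S(1) z(2,1) AB(1-4,6,7,9)] by (elim exE conjE)
    show ?thesis
    proof (rule path_cover_near_tight[OF st S(1) Sne AB(8,4,5) _ Y(2) _ IH])
      show "Y \<subseteq> A \<union> B" using Y(1) by auto
      show "path_cover E (Q \<union> (A \<union> B))"
        if "d \<in> Y" "E s d" "rooted_cover E 2 Q s" "Q \<inter> (A \<union> B) = {}" for Q s d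
        using Y(3) that by (elim allE[of _ Q] allE[of _ s] allE[of _ d]) simp
    qed
  qed
qed

end

theorem kaneko:
  assumes "simple_rel E" "sun_bounded E V" shows "path_cover E V"
proof -
  have "finite V" using assms(2) by (simp add: sun_bounded_def)
  thus ?thesis using assms
  proof (induction V arbitrary: E rule: finite_psubset_induct)
    case (psubset V)
    note outer = psubset.IH
    \<comment> \<open>The inner induction fixes \<open>V\<close> and varies the relation; its
      measure counts ordered pairs, so each edge counts twice.\<close>
    from psubset.prems show ?case
    proof (induction "card {(a, b). a \<in> V \<and> b \<in> V \<and> E a b}" arbitrary: E rule: less_induct)
      case (less E)
      interpret simple_rel E by fact
      have IH: "path_cover E W" if "W \<subset> V" "sun_bounded E W" for W using outer[OF that(1) less.prems(1) that(2)] .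
      show ?case
      proof (cases "conn_set E V")
        case False
        show ?thesis by (rule path_cover_disconnected[OF less.prems(2) False IH])
      next
        case conn: True
        show ?thesis
        proof (cases "\<exists>S\<subseteq>V. S \<noteq> {} \<and> sun_number E (V - S) = 2 * card S")
          case True
          then obtain S where "S \<subseteq> V" "S \<noteq> {}" "sun_number E (V - S) = 2 * card S" by auto
          thus ?thesis by (intro path_cover_tight[OF less.prems(2) _ _ _ IH]) auto
        next
          case False
          have ns: "\<not> sun_set E V" using sun_boundedD[OF less.prems(2), of "{}"] sun_number_conn[OF conn] by auto
          have "sun_number E (V - X) < 2 * card X" if "X \<subseteq> V" "X \<noteq> {}" for X
            using False sun_boundedD[OF less.prems(2) that(1)] that by (meson le_neq_implies_less)
          hence st: "strictly_sun_bounded E V" using psubset.hyps conn ns by (simp add: strictly_sun_bounded_def)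
          have "\<exists>y\<in>V. (\<nexists>w. leaf_of E V y w) \<and> (\<nexists>l. leaf_of E V l y)"
            by (rule exists_plain_vertex[OF st IH])
          then obtain y where y: "y \<in> V" "\<nexists>w. leaf_of E V y w" "\<nexists>l. leaf_of E V l y" by blast
          have Vy: "V \<noteq> {y}" using ns sun_set_sing[of E y] by metis
          show ?thesis
          proof (cases "conn_set E (V - {y})")
            case nc: True
            obtain z where z: "z \<in> V" "E y z"
            proof -
              have "\<not> no_edge E {y} (V - {y})" using conn_setD[OF conn, of "{y}"] y(1) Vy by auto
              thus ?thesis using that by (auto simp: no_edge_def)
            qed
            have "path_cover (del_edge E y z) V" if "sun_bounded (del_edge E y z) V"
            proof (rule less.hyps[OF _ simple_rel_del_edge that])
              show "card {(a, b). a \<in> V \<and> b \<in> V \<and> del_edge E y z a b} < card {(a, b). a \<in> V \<and> b \<in> V \<and> E a b}"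
              proof (rule psubset_card_mono)
                show "finite {(a, b). a \<in> V \<and> b \<in> V \<and> E a b}"
                  by (rule finite_subset[of _ "V \<times> V"]) (use psubset.hyps in auto)
                have "(y, z) \<in> {(a, b). a \<in> V \<and> b \<in> V \<and> E a b} - {(a, b). a \<in> V \<and> b \<in> V \<and> del_edge E y z a b}"
                  using y(1) z by (auto simp: del_edge_def)
                thus "{(a, b). a \<in> V \<and> b \<in> V \<and> del_edge E y z a b} \<subset> {(a, b). a \<in> V \<and> b \<in> V \<and> E a b}"
                  by (auto simp: del_edge_def)
              qed
            qed
            note ih = this
            show ?thesis by (rule path_cover_edge_step[OF st nc y z IH ih])
          next
            case nc: False
            show ?thesis by (rule path_cover_cut_vertex[OF st y(1,3) Vy nc IH])
          qed
        qed
      qed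
    qed
  qed
qed

section \<open>Path factors of library graphs\<close>

definition adj :: "('a,'b) pre_digraph \<Rightarrow> 'a \<Rightarrow> 'a \<Rightarrow> bool" where
  "adj G x y \<longleftrightarrow> (x, y) \<in> arcs_ends G"

lemma simple_rel_adj: "graph G \<Longrightarrow> simple_rel (adj G)"
proof -
  assume "graph G"
  then interpret graph G .
  show ?thesis by unfold_locales (use graph_symmetric adj_not_same in \<open>auto simp: adj_def\<close>)
qed

lemma graph_induce:
  assumes "graph G" "C \<subseteq> verts G" shows "graph (G \<restriction> C)"
proof -
  interpret graph G by fact
  show ?thesis using induced_graph_imp_graph[OF induced_induce[OF assms(2)]]
    by (metis assms(2) digraphI_induced graph_def induced_induce pseudo_graph_def digraph_def
        induced_graph_imp_symmetric sym_arcs sym_digraph_def sym_digraph_axioms_def)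
qed

lemma adj_induce: "x \<in> C \<Longrightarrow> y \<in> C \<Longrightarrow> adj (G \<restriction> C) x y = adj G x y"
  by (auto simp: adj_def arcs_ends_conv)

text \<open>The vertices of \<open>C\<close> reachable from \<open>a\<close> form a closed subset of
  \<open>C\<close>.\<close>

lemma conn_set_reachable:
  assumes "graph G" "C \<subseteq> verts G" "conn_set (adj G) C" "a \<in> C" "b \<in> C"
  shows "a \<rightarrow>\<^sup>*\<^bsub>G\<^esub> b"
proof -
  interpret graph G by fact
  have "{w\<in>C. a \<rightarrow>\<^sup>*\<^bsub>G\<^esub> w} = C"
  proof (rule conn_setD[OF assms(3)])
    show "no_edge (adj G) {w \<in> C. a \<rightarrow>\<^sup>*\<^bsub>G\<^esub> w} (C - {w \<in> C. a \<rightarrow>\<^sup>*\<^bsub>G\<^esub> w})"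
      unfolding no_edge_def adj_def using reachable_adj_trans by blast
    have "a \<rightarrow>\<^sup>*\<^bsub>G\<^esub> a" using assms by auto
    thus "{w \<in> C. a \<rightarrow>\<^sup>*\<^bsub>G\<^esub> w} \<noteq> {}" using assms(4) by auto
  qed auto
  thus ?thesis using assms(5) by auto
qed

lemma closed_reachable:
  assumes "graph G" "no_edge (adj G) C (verts G - C)" "a \<in> C" "a \<rightarrow>\<^sup>*\<^bsub>G\<^esub> b"
  shows "b \<in> C"
proof -
  interpret graph G by fact
  show ?thesis using assms(4)
  proof (induction rule: reachable_induct)
    case (step x y)
    show ?case
    proof (rule ccontr)
      assume "y \<notin> C"
      moreover have "y \<in> verts G" using adj_in_verts step(2) by auto
      ultimately show False using assms(2) step by (auto simp: no_edge_def adj_def)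
    qed
  qed (use assms(3) in auto)
qed

lemma conn_set_if_reachable:
  assumes "graph G" "S \<noteq> {}" "S \<subseteq> verts G" "no_edge (adj G) S (verts G - S)"
    "\<And>a b. a \<in> S \<Longrightarrow> b \<in> S \<Longrightarrow> a \<rightarrow>\<^sup>*\<^bsub>G\<^esub> b"
  shows "conn_set (adj G) S"
  unfolding conn_set_def
proof (intro conjI allI impI)
  fix B assume B: "B \<subseteq> S \<and> B \<noteq> {} \<and> no_edge (adj G) B (S - B)"
  then obtain a where a: "a \<in> B" by auto
  have "no_edge (adj G) B (verts G - B)" using B assms(4) unfolding no_edge_def by blast
  hence "b \<in> B" if "b \<in> S" for b
    using closed_reachable[OF assms(1) _ a] assms(5)[of a b] a B that by blast
  thus "B = S" using B by auto
qed (rule assms(2))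

text \<open>Adjacency is symmetric, so no edge leaves a class of mutual reachability, and such
  classes are exactly the closed connected sets.\<close>

lemma sccs_verts_comps:
  assumes "graph G" shows "pre_digraph.sccs_verts G = comps (adj G) (verts G)"
proof -
  interpret graph G by fact
  show ?thesis
  proof (intro equalityI subsetI)
    fix S assume S: "S \<in> sccs_verts"
    have ne: "S \<noteq> {}" and r: "\<And>a b. a \<in> S \<Longrightarrow> b \<in> S \<Longrightarrow> a \<rightarrow>\<^sup>*\<^bsub>G\<^esub> b"
      and nr: "\<And>a b. a \<in> S \<Longrightarrow> b \<notin> S \<Longrightarrow> \<not> a \<rightarrow>\<^sup>*\<^bsub>G\<^esub> b \<or> \<not> b \<rightarrow>\<^sup>*\<^bsub>G\<^esub> a"
      using S unfolding in_sccs_verts_conv_reachable by blast+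
    have sub: "S \<subseteq> verts G" using r reachable_in_verts by blast
    have cl: "no_edge (adj G) S (verts G - S)"
      unfolding no_edge_def adj_def
    proof (intro ballI notI)
      fix a b assume "a \<in> S" "b \<in> verts G - S" "(a, b) \<in> arcs_ends G"
      thus False using nr[of a b] graph_symmetric[of a b] by auto
    qed
    show "S \<in> comps (adj G) (verts G)"
      using sub cl conn_set_if_reachable[OF assms ne sub cl r] by (simp add: comps_def)
  next
    fix S assume S: "S \<in> comps (adj G) (verts G)"
    hence s: "S \<subseteq> verts G" "conn_set (adj G) S" "no_edge (adj G) S (verts G - S)"
      by (auto simp: comps_def)
    have "S \<noteq> {}" using comps_ne[OF S] .
    moreover have "a \<rightarrow>\<^sup>*\<^bsub>G\<^esub> b" if "a \<in> S" "b \<in> S" for a b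
      using conn_set_reachable[OF assms s(1,2) that] .
    moreover have "\<not> a \<rightarrow>\<^sup>*\<^bsub>G\<^esub> b" if "a \<in> S" "b \<notin> S" for a b
      using closed_reachable[OF assms s(3) that(1)] that(2) by auto
    ultimately show "S \<in> sccs_verts" unfolding in_sccs_verts_conv_reachable by blast
  qed
qed

lemma conn_set_connected:
  assumes "graph G" "connected G" shows "conn_set (adj G) (verts G)"
proof -
  interpret graph G by fact
  have "strongly_connected (mk_symmetric G)" using assms(2) by (simp add: connected_def)
  hence "verts G \<noteq> {}" "\<And>a b. a \<in> verts G \<Longrightarrow> b \<in> verts G \<Longrightarrow> a \<rightarrow>\<^sup>*\<^bsub>G\<^esub> b"
    using reachable_mk_symmetric_eq[OF sym_arcs] by (auto simp: strongly_connected_def)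
  thus ?thesis by (intro conn_set_if_reachable[OF assms(1)]) (auto simp: no_edge_def)
qed

section \<open>Isomorphisms, matchings and suns of library graphs\<close>

lemma digraph_iso_pairI:
  fixes P :: "'c pair_pre_digraph" and K :: "('a,'b) pre_digraph"
  assumes K: "graph K" and P: "wf_digraph (with_proj P)" and f: "bij_betw f (pverts P) (verts K)"
    and e: "\<And>a b. a \<in> pverts P \<Longrightarrow> b \<in> pverts P \<Longrightarrow> (a, b) \<in> parcs P \<longleftrightarrow> adj K (f a) (f b)"
  shows "digraph_iso (with_proj P) K"
proof -
  interpret K: graph K by fact
  interpret P: wf_digraph "with_proj P" by fact
  have injf: "inj_on f (pverts P)" and imf: "f ` pverts P = verts K" using f by (auto simp: bij_betw_def)
  have inP: "fst p \<in> pverts P \<and> snd p \<in> pverts P" if "p \<in> parcs P" for p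
    using P.tail_in_verts[of p] P.head_in_verts[of p] that by simp
  \<comment> \<open>In a graph without parallel arcs an arc is determined by its ends, so the arc
    map is forced by the vertex map \<open>f\<close>.\<close>
  define g where "g p = the_inv_into (arcs K) (arc_to_ends K) (f (fst p), f (snd p))" for p
  have inj: "inj_on (arc_to_ends K) (arcs K)" by (rule K.inj_on_arc_to_ends)
  have g: "g p \<in> arcs K \<and> arc_to_ends K (g p) = (f (fst p), f (snd p))" if "p \<in> parcs P" for p
  proof -
    have "(f (fst p), f (snd p)) \<in> arc_to_ends K ` arcs K"
      using e[of "fst p" "snd p"] inP[OF that] that by (simp add: adj_def arcs_ends_def)
    thus ?thesis unfolding g_def
      using f_the_inv_into_f[OF inj] the_inv_into_into[OF inj _ subset_refl] by metis
  qed
  define h where "h = \<lparr>iso_verts = f, iso_arcs = g, iso_head = head K, iso_tail = tail K\<rparr>"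
  have "pre_digraph.digraph_isomorphism (with_proj P) h"
    unfolding pre_digraph.digraph_isomorphism_def
  proof (intro conjI ballI)
    show "wf_digraph (with_proj P)" by fact
    show "inj_on (iso_verts h) (verts (with_proj P))" using injf by (simp add: h_def)
    show "inj_on (iso_arcs h) (arcs (with_proj P))"
    proof (rule inj_onI)
      fix p q assume pq: "p \<in> arcs (with_proj P)" "q \<in> arcs (with_proj P)" "iso_arcs h p = iso_arcs h q"
      hence "(f (fst p), f (snd p)) = (f (fst q), f (snd q))" using g[of p] g[of q] by (simp add: h_def)
      thus "p = q" using injf inP[of p] inP[of q] pq by (auto simp: prod_eq_iff dest: inj_onD)
    qed
    fix p assume p: "p \<in> arcs (with_proj P)"
    show "iso_verts h (tail (with_proj P) p) = iso_tail h (iso_arcs h p)"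
      "iso_verts h (head (with_proj P) p) = iso_head h (iso_arcs h p)"
      using g[of p] p by (auto simp: h_def arc_to_ends_def)
  qed
  moreover have "K = app_iso h (with_proj P)"
  proof -
    have "g ` parcs P = arcs K"
    proof (intro equalityI subsetI)
      fix x assume x: "x \<in> arcs K"
      obtain a b where ab: "a \<in> pverts P" "b \<in> pverts P" "tail K x = f a" "head K x = f b"
        using imf K.tail_in_verts[OF x] K.head_in_verts[OF x] by (metis imageE)
      have "(tail K x, head K x) \<in> arcs_ends K" using x by (auto simp: arcs_ends_conv)
      hence "adj K (f a) (f b)" by (simp add: adj_def ab)
      hence p: "(a, b) \<in> parcs P" using e ab by auto
      have "arc_to_ends K (g (a, b)) = arc_to_ends K x" using g[OF p] ab by (simp add: arc_to_ends_def)
      hence "g (a, b) = x" using inj_onD[OF inj] g[OF p] x by blast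
      thus "x \<in> g ` parcs P" using p by force
    qed (use g in auto)
    thus ?thesis using imf by (intro pre_digraph.equality) (simp_all add: app_iso_def h_def)
  qed
  ultimately show ?thesis unfolding digraph_iso_def by blast
qed

lemma graph_pairI:
  assumes "finite (pverts P)" "\<And>a b. (a, b) \<in> parcs P \<Longrightarrow> a \<in> pverts P \<and> b \<in> pverts P \<and> a \<noteq> b \<and> (b, a) \<in> parcs P"
  shows "graph (with_proj P)"
proof -
  have "finite (parcs P)"
    by (rule finite_subset[of _ "pverts P \<times> pverts P"]) (use assms in auto)
  moreover have "symmetric (with_proj P)" using assms(2) by (auto simp: symmetric_def sym_def)
  ultimately show ?thesis using assms
    by unfold_locales (auto simp: arc_to_ends_def)
qed

lemma factor_critical_pairI:
  fixes P :: "'a pair_pre_digraph"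
  assumes g: "graph (with_proj P)" and fc: "fc_set (\<lambda>a b. (a, b) \<in> parcs P) (pverts P)"
  shows "factor_critical (with_proj P)"
  unfolding factor_critical_def
proof (intro conjI ballI g)
  interpret graph "with_proj P" by fact
  fix v assume v: "v \<in> verts (with_proj P)"
  have "has_pm (\<lambda>a b. (a, b) \<in> parcs P) (pverts P - {v})" using fc v by (simp add: fc_set_def)
  then obtain m where m: "\<And>x. x \<in> pverts P - {v} \<Longrightarrow> m x \<in> pverts P - {v} \<and> m (m x) = x \<and> (x, m x) \<in> parcs P"
    unfolding has_pm_def by blast
  have ne: "x \<noteq> m x" if "x \<in> pverts P - {v}" for x using m[OF that] no_loops[of "(x, m x)"] by auto
  \<comment> \<open>The matching consists of the arcs from \<open>x\<close> to \<open>m x\<close>.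
    The involution property makes it symmetric, and each vertex has exactly one outgoing
    arc.\<close>
  define M where "M = \<lparr>pverts = pverts P - {v}, parcs = {(x, m x) |x. x \<in> pverts P - {v}}\<rparr>"
  have gM: "graph (with_proj M)"
  proof (rule graph_pairI)
    fix a b assume "(a, b) \<in> parcs M"
    hence "a \<in> pverts P - {v}" "b = m a" by (auto simp: M_def)
    thus "a \<in> pverts M \<and> b \<in> pverts M \<and> a \<noteq> b \<and> (b, a) \<in> parcs M"
      using m[of a] ne[of a] by (auto simp: M_def)
  qed (use finite_verts in \<open>simp add: M_def\<close>)
  interpret M: graph "with_proj M" by (rule gM)
  have "spanning (with_proj M) (del_verts (with_proj P) {v})"
    unfolding spanning_def
  proof
    show "subgraph (with_proj M) (del_verts (with_proj P) {v})"
    proof (rule subgraphI)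
      show "wf_digraph (del_verts (with_proj P) {v})" by (simp add: del_verts_def wellformed_induce_subgraph)
      show "wf_digraph (with_proj M)" by (rule M.wf_digraph)
      show "arcs (with_proj M) \<subseteq> arcs (del_verts (with_proj P) {v})"
      proof
        fix e assume "e \<in> arcs (with_proj M)"
        then obtain x where "x \<in> pverts P - {v}" "e = (x, m x)" by (auto simp: M_def)
        thus "e \<in> arcs (del_verts (with_proj P) {v})" using m[of x] by (simp add: del_verts_def)
      qed
    qed (auto simp: M_def del_verts_def compatible_def)
  qed (auto simp: M_def del_verts_def)
  moreover have "out_degree (with_proj M) x = 1" if "x \<in> verts (with_proj M)" for x
  proof -
    have "out_arcs (with_proj M) x = {(x, m x)}" using that by (auto simp: out_arcs_def M_def)
    thus ?thesis by (simp add: out_degree_def)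
  qed
  ultimately show "\<exists>M. perfect_matching M (del_verts (with_proj P) {v})"
    using gM unfolding perfect_matching_def by blast
qed

text \<open>The base is taken as a pair digraph on \<open>H\<close> itself; \<open>Inl\<close>
  copies are sent to themselves and \<open>Inr\<close> copies to their pendants by \<open>u\<close>.
  \<open>K_2\<close> appears here as the corona over one vertex.\<close>

lemma is_sun_if_sun_set:
  fixes K :: "('a,'b) pre_digraph"
  assumes K: "graph K" and s: "sun_set (adj K) (verts K)"
  shows "is_sun K"
proof (cases "\<exists>x. verts K = {x}")
  case True
  then obtain x where x: "verts K = {x}" by auto
  interpret K: graph K by fact
  have "(a, b) \<notin> arcs_ends K" for a b using K.adj_in_verts[of a b] K.adj_not_same[of a] x by auto
  hence "arcs_ends K = {}" by auto
  hence "complete_digraph 1 K" using x K by (auto simp: complete_digraph_def)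
  thus ?thesis by (simp add: is_sun_def)
next
  case False
  interpret K: graph K by fact
  interpret E: simple_rel "adj K" by (rule simple_rel_adj[OF K])
  obtain H u where H: "corona (adj K) (verts K) H u" "fc_set (adj K) H"
    using s False by (auto simp: sun_set_def)
  have HV: "H \<subseteq> verts K" using H(1) by (simp add: corona_def)
  define P where "P = \<lparr>pverts = H, parcs = {(a, b). a \<in> H \<and> b \<in> H \<and> adj K a b}\<rparr>"
  have finH: "finite H" using finite_subset[OF HV] by simp
  have gP: "graph (with_proj P)"
    by (rule graph_pairI) (use finH E.sym E.irr in \<open>auto simp: P_def\<close>)
  have "fc_set (adj K) H = fc_set (\<lambda>a b. (a, b) \<in> parcs P) H"
    by (rule fc_set_cong) (simp add: P_def)
  hence fcP: "factor_critical (with_proj P)"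
    using factor_critical_pairI[OF gP] H(2) by (simp add: P_def)
  define f where "f = case_sum (\<lambda>x. x) u"
  have fs[simp]: "f (Inl x) = x" "f (Inr x) = u x" for x by (simp_all add: f_def)
  have Q: "pverts (add_pendants P) = Inl ` H \<union> Inr ` H" by (simp add: add_pendants_def P_def)
  note dj = E.corona_disj[OF H(1)] and ij = E.corona_inj[OF H(1)]
  have leafE: "adj K (u v) x \<longleftrightarrow> x = v" "adj K x (u v) \<longleftrightarrow> x = v" if "v \<in> H" "x \<in> verts K" for v x
    using H(1) that E.sym unfolding corona_def by blast+
  have "digraph_iso (with_proj (add_pendants P)) K"
  proof (rule digraph_iso_pairI[OF K])
    show "wf_digraph (with_proj (add_pendants P))"
      by unfold_locales (auto simp: add_pendants_def P_def)
    show "bij_betw f (pverts (add_pendants P)) (verts K)"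
      unfolding bij_betw_def
    proof
      show "inj_on f (pverts (add_pendants P))"
        unfolding Q using dj ij dj[THEN not_sym] by (auto simp: inj_on_def)
      show "f ` pverts (add_pendants P) = verts K"
        using H(1) unfolding Q image_Un image_image by (auto simp: corona_def)
    qed
    fix a b assume ab: "a \<in> pverts (add_pendants P)" "b \<in> pverts (add_pendants P)"
    have mem: "v \<in> verts K" "u v \<in> verts K" if "v \<in> H" for v using E.corona_mem[OF H(1) that] by auto
    show "(a, b) \<in> parcs (add_pendants P) \<longleftrightarrow> adj K (f a) (f b)"
      using ab leafE mem dj unfolding Q by (auto simp: add_pendants_def P_def)
  qed
  thus ?thesis using fcP unfolding is_sun_def by blast
qed

text \<open>This is the direction in which toughness is used: its bound on \<open>sun_count\<close>
  passes to \<open>sun_number\<close>. Distinct vertex sets induce distinct subgraphs, so the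
  counting is by an injection.\<close>

lemma sun_number_le_sun_count:
  fixes G :: "('a,'b) pre_digraph"
  assumes G: "graph G" shows "sun_number (adj G) (verts G) \<le> sun_count G"
proof -
  interpret graph G by fact
  have sccs: "sccs = induce_subgraph G ` comps (adj G) (verts G)"
    using sccs_conv_sccs_verts sccs_verts_comps[OF G] by simp
  have "inj_on (induce_subgraph G) (suns (adj G) (verts G))"
    by (rule inj_onI) (metis induce_subgraph_verts)
  moreover have "induce_subgraph G ` suns (adj G) (verts G) \<subseteq> {C \<in> sccs. is_sun C}"
  proof
    fix D assume "D \<in> induce_subgraph G ` suns (adj G) (verts G)"
    then obtain C where C: "C \<in> comps (adj G) (verts G)" "sun_set (adj G) C" "D = G \<restriction> C"
      by (auto simp: suns_def)
    have "sun_set (adj (G \<restriction> C)) C = sun_set (adj G) C" by (rule sun_set_cong) (rule adj_induce)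
    hence "sun_set (adj (G \<restriction> C)) C" using C(2) by simp
    hence "is_sun (G \<restriction> C)" by (intro is_sun_if_sun_set graph_induce[OF G comps_subset[OF C(1)]]) simp
    thus "D \<in> {C \<in> sccs. is_sun C}" using C sccs by auto
  qed
  moreover have "finite sccs" unfolding sccs by (intro finite_imageI finite_comps finite_verts)
  hence "finite {C \<in> sccs. is_sun C}" by simp
  ultimately show ?thesis unfolding sun_number_def sun_count_def by (metis card_image card_mono)
qed

section \<open>From path covers to path factors\<close>

lemma (in simple_rel) conn_set_path: "successively E p \<Longrightarrow> p \<noteq> [] \<Longrightarrow> conn_set E (set p)"
proof (induction p rule: induct_list012)
  case (3 x y zs)
  hence "conn_set E (insert x (set (y # zs)))" by (intro conn_insert_vertex[of _ y]) auto
  thus ?case by simp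
qed (auto simp: conn_set_sing)

text \<open>The factor keeps just the arcs of \<open>K\<close> between consecutive vertices of a
  path. Chords must go, since a component of the factor has to be isomorphic to a path. Disjointness
  of the paths makes their vertex sets the components.\<close>

lemma path_factor_if_path_cover:
  fixes K :: "('a,'b) pre_digraph"
  assumes K: "graph K" and "path_cover (adj K) (verts K)"
  shows "\<exists>F. path_factor 3 F K"
proof -
  interpret K: graph K by fact
  obtain P where P: "\<And>p. p \<in> P \<Longrightarrow> distinct p" "\<And>p. p \<in> P \<Longrightarrow> successively (adj K) p"
    "\<And>p. p \<in> P \<Longrightarrow> 3 \<le> length p" "(\<Union>p\<in>P. set p) = verts K"
    "\<And>p q. p \<in> P \<Longrightarrow> q \<in> P \<Longrightarrow> p \<noteq> q \<Longrightarrow> set p \<inter> set q = {}"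
    using path_cover_set[OF assms(2)] unfolding simple_path_def by metis
  define R where "R x y \<longleftrightarrow> (\<exists>p\<in>P. \<exists>i. Suc i < length p \<and> (x = p ! i \<and> y = p ! Suc i \<or> y = p ! i \<and> x = p ! Suc i))" for x y
  have Rsym: "R x y \<Longrightarrow> R y x" for x y by (auto simp: R_def)
  have sub: "set p \<subseteq> verts K" if "p \<in> P" for p using P(4) that by auto
  define F where "F = \<lparr>verts = verts K, arcs = {e \<in> arcs K. R (tail K e) (head K e)}, tail = tail K, head = head K\<rparr>"
  have adjF: "adj F x y \<longleftrightarrow> adj K x y \<and> R x y" for x y
    by (auto simp: adj_def arcs_ends_conv F_def)
  have "wf_digraph F" by unfold_locales (auto simp: F_def)
  hence subF: "subgraph F K" by (intro subgraphI K.wf_digraph) (auto simp: F_def compatible_def)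
  interpret F: digraph F by (rule K.digraph_subgraph[OF subF])
  have "symmetric F"
    unfolding symmetric_def sym_def
    using adjF Rsym K.graph_symmetric unfolding adj_def by blast
  hence gF: "graph F" by (rule F.graphI)
  interpret EF: simple_rel "adj F" by (rule simple_rel_adj[OF gF])
  have sucF: "adj F (p ! i) (p ! Suc i)" if "p \<in> P" "Suc i < length p" for p i
    using P(2)[OF that(1)] that unfolding adjF R_def successively_conv_nth by blast
  have Rin: "y \<in> set p" if R: "R x y" and x: "x \<in> set p" and p: "p \<in> P" for x y p
  proof -
    obtain q i where q: "q \<in> P" "Suc i < length q" "x = q ! i \<and> y = q ! Suc i \<or> y = q ! i \<and> x = q ! Suc i"
      using R unfolding R_def by blast
    hence xy: "x \<in> set q" "y \<in> set q" by (auto simp: nth_mem)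
    hence "q = p" using P(5)[OF q(1) p] x by auto
    thus ?thesis using xy by simp
  qed
  have comp: "set p \<in> comps (adj F) (verts F)" if p: "p \<in> P" for p
  proof -
    have "successively (adj F) p" using sucF[OF p] by (simp add: successively_conv_nth)
    hence "conn_set (adj F) (set p)" using P(3)[OF p] by (intro EF.conn_set_path) auto
    moreover have "no_edge (adj F) (set p) (verts F - set p)"
      unfolding no_edge_def adjF using Rin p by blast
    ultimately show ?thesis using sub[OF p] by (simp add: comps_def F_def)
  qed
  have "path_factor 3 F K"
    unfolding path_factor_def
  proof (intro conjI ballI gF)
    show "spanning F K" using subF by (simp add: spanning_def F_def)
    fix C assume "C \<in> pre_digraph.sccs F"
    then obtain S where S: "S \<in> comps (adj F) (verts F)" "C = F \<restriction> S"
      using F.sccs_conv_sccs_verts sccs_verts_comps[OF gF] by auto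
    obtain x where x: "x \<in> S" using comps_ne[OF S(1)] by auto
    then obtain p where p: "p \<in> P" "x \<in> set p" using comps_subset[OF S(1)] P(4) by (auto simp: F_def)
    have Sp: "S = set p" by (rule comps_disj[OF S(1) comp[OF p(1)]]) (use x p in auto)
    have "digraph_iso (with_proj (path_graph (length p))) C"
    proof (rule digraph_iso_pairI[where f = "(!) p"])
      show "graph C" unfolding S(2) by (rule graph_induce[OF gF comps_subset[OF S(1)]])
      show "wf_digraph (with_proj (path_graph (length p)))"
        by unfold_locales (auto simp: path_graph_def)
      show "bij_betw ((!) p) (pverts (path_graph (length p))) (verts C)"
        using bij_betw_nth[OF P(1)[OF p(1)]] by (simp add: path_graph_def S(2) Sp)
      fix i j assume "i \<in> pverts (path_graph (length p))" "j \<in> pverts (path_graph (length p))"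
      hence ij: "i < length p" "j < length p" by (auto simp: path_graph_def)
      have "adj C (p ! i) (p ! j) = adj F (p ! i) (p ! j)"
        unfolding S(2) Sp by (rule adj_induce) (use ij in auto)
      also have "\<dots> \<longleftrightarrow> j = Suc i \<or> i = Suc j"
      proof
        assume "adj F (p ! i) (p ! j)"
        then obtain q k where q: "q \<in> P" "Suc k < length q"
          "p ! i = q ! k \<and> p ! j = q ! Suc k \<or> p ! j = q ! k \<and> p ! i = q ! Suc k"
          unfolding adjF R_def by blast
        have "p ! i \<in> set q" using q by (auto simp: nth_mem)
        hence "q = p" using P(5)[OF q(1) p(1)] nth_mem[OF ij(1)] by blast
        thus "j = Suc i \<or> i = Suc j" using q ij P(1)[OF p(1)] by (auto simp: nth_eq_iff_index_eq)
      next
        assume "j = Suc i \<or> i = Suc j"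
        thus "adj F (p ! i) (p ! j)" using sucF[OF p(1)] ij EF.sym by auto
      qed
      finally show "(i, j) \<in> parcs (path_graph (length p)) \<longleftrightarrow> adj C (p ! i) (p ! j)"
        using ij by (auto simp: path_graph_def)
    qed
    thus "\<exists>n\<ge>3. digraph_iso (with_proj (path_graph n)) C" using P(3)[OF p(1)] by blast
  qed
  thus ?thesis by blast
qed

section \<open>Connectivity and toughness under vertex deletion\<close>

lemma adj_del_verts:
  "x \<in> verts G - Y \<Longrightarrow> y \<in> verts G - Y \<Longrightarrow> adj (del_verts G Y) x y = adj G x y"
  unfolding del_verts_def by (rule adj_induce)

lemma verts_del_verts[simp]: "verts (del_verts G Y) = verts G - Y"
  by (simp add: del_verts_def)

lemma graph_del_verts: "graph G \<Longrightarrow> graph (del_verts G Y)"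
  unfolding del_verts_def by (rule graph_induce) auto

lemma conn_set_del_verts:
  assumes "graph G" "connected (del_verts G Y)" shows "conn_set (adj G) (verts G - Y)"
proof -
  have "conn_set (adj (del_verts G Y)) (verts G - Y) = conn_set (adj G) (verts G - Y)"
    by (rule conn_set_cong) (rule adj_del_verts)
  thus ?thesis using conn_set_connected[OF graph_del_verts[OF assms(1)] assms(2)] by simp
qed

lemma sun_number_del_verts:
  assumes "graph G" shows "sun_number (adj G) (verts G - Y) \<le> sun_count (del_verts G Y)"
proof -
  have "sun_number (adj (del_verts G Y)) (verts G - Y) = sun_number (adj G) (verts G - Y)"
    by (rule sun_number_cong) (rule adj_del_verts)
  thus ?thesis using sun_number_le_sun_count[OF graph_del_verts[OF assms, of Y]] by simp
qed

lemma complete_adj: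
  assumes "is_complete G" "x \<in> verts G" "y \<in> verts G" "x \<noteq> y" shows "adj G x y"
  using assms by (auto simp: is_complete_def complete_digraph_def adj_def)

lemma not_complete_nonadjacent:
  assumes G: "graph G" and "\<not> is_complete G"
  obtains x y where "x \<in> verts G" "y \<in> verts G" "x \<noteq> y" "\<not> adj G x y"
proof -
  interpret graph G by fact
  have "arcs_ends G \<subseteq> {(u, v). (u, v) \<in> verts G \<times> verts G \<and> u \<noteq> v}"
    using adj_in_verts adj_not_same by auto
  hence "\<exists>x y. x \<in> verts G \<and> y \<in> verts G \<and> x \<noteq> y \<and> \<not> adj G x y"
    using assms by (auto simp: is_complete_def complete_digraph_def adj_def)
  thus ?thesis using that by blast
qed

lemma conn_set_complete:
  assumes "is_complete G" "C \<subseteq> verts G" "C \<noteq> {}" shows "conn_set (adj G) C"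
  unfolding conn_set_def
proof (intro conjI allI impI assms(3))
  fix B assume B: "B \<subseteq> C \<and> B \<noteq> {} \<and> no_edge (adj G) B (C - B)"
  show "B = C"
  proof (rule ccontr)
    assume "B \<noteq> C"
    then obtain a b where "a \<in> B" "b \<in> C - B" using B by blast
    thus False using complete_adj[OF assms(1), of a b] B assms(2) by (auto simp: no_edge_def)
  qed
qed

text \<open>For a graph that is not complete, the vertices outside a nonadjacent pair form a
  disconnecting set, so there are at least \<open>k\<close> of them. The first claim also shows that
  a set of fewer than \<open>k\<close> vertices is proper, as membership in the family of the
  minimum demands.\<close>

lemma vertex_connectivityD:
  assumes G: "graph G" and k: "k \<le> vertex_connectivity G" "0 < k"
  shows "k < card (verts G)"
    and "Y \<subseteq> verts G \<Longrightarrow> card Y < k \<Longrightarrow> conn_set (adj G) (verts G - Y)"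
proof -
  interpret graph G by fact
  define F where "F = {X. X \<subset> verts G \<and> \<not> connected (del_verts G X)}"
  have finF: "finite (card ` F)"
    by (rule finite_imageI, rule finite_subset[of _ "Pow (verts G)"]) (auto simp: F_def)
  have vc: "k \<le> card X" if "X \<in> F" "\<not> is_complete G" for X
    using k(1) that Min_le[OF finF, of "card X"] by (simp add: vertex_connectivity_def F_def)
  show kc: "k < card (verts G)"
  proof (cases "is_complete G")
    case True thus ?thesis using k by (simp add: vertex_connectivity_def)
  next
    case False
    obtain x y where xy: "x \<in> verts G" "y \<in> verts G" "x \<noteq> y" "\<not> adj G x y"
      using not_complete_nonadjacent[OF G False] .
    have "\<not> connected (del_verts G (verts G - {x, y}))"
    proof
      assume "connected (del_verts G (verts G - {x, y}))"
      moreover have "verts G - (verts G - {x, y}) = {x, y}" using xy by auto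
      ultimately have "conn_set (adj G) {x, y}"
        using conn_set_del_verts[OF G, of "verts G - {x, y}"] by simp
      hence "{x} = {x, y}" by (rule conn_setD) (use xy in \<open>auto simp: no_edge_def\<close>)
      thus False using xy by auto
    qed
    hence "verts G - {x, y} \<in> F" using xy by (auto simp: F_def)
    hence "k \<le> card (verts G - {x, y})" by (rule vc[OF _ False])
    also have "\<dots> < card (verts G)" by (rule psubset_card_mono) (use xy in auto)
    finally show ?thesis .
  qed
  assume Y: "Y \<subseteq> verts G" "card Y < k"
  have ps: "Y \<subset> verts G" using Y kc by auto
  show "conn_set (adj G) (verts G - Y)"
  proof (cases "is_complete G")
    case True thus ?thesis by (rule conn_set_complete) (use ps in auto)
  next
    case False
    have "Y \<notin> F" using vc[OF _ False, of Y] Y by auto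
    thus ?thesis using ps by (intro conn_set_del_verts[OF G]) (auto simp: F_def)
  qed
qed

text \<open>The minimum is evaluated at \<open>X\<close> and multiplied out. For complete
  \<open>G\<close> the toughness is infinite, but then what remains after deleting \<open>X\<close>
  is connected and has at most one sun.\<close>

lemma sun_toughnessD:
  assumes G: "graph G" and t: "ereal t < sun_toughness G" and X: "X \<subseteq> verts G" "2 \<le> sun_number (adj G) (verts G - X)"
  shows "t * real (sun_number (adj G) (verts G - X)) < real (card X)"
proof (cases "is_complete G")
  case True
  have "verts G - X \<noteq> {}"
  proof
    assume "verts G - X = {}"
    thus False using X(2) by (simp only: sun_number_empty)
  qed
  hence "conn_set (adj G) (verts G - X)" by (intro conn_set_complete[OF True]) auto
  thus ?thesis using X(2) sun_number_conn[of "adj G" "verts G - X"] by (simp split: if_splits)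
next
  case False
  interpret graph G by fact
  define s where "s = sun_count (del_verts G X)"
  define F where "F = (\<lambda>X. ereal (real (card X) / real (sun_count (del_verts G X)))) `
            {X. X \<subseteq> verts G \<and> 2 \<le> sun_count (del_verts G X)}"
  have ss: "sun_number (adj G) (verts G - X) \<le> s" unfolding s_def by (rule sun_number_del_verts[OF G])
  have "finite F" unfolding F_def
    by (rule finite_imageI, rule finite_subset[of _ "Pow (verts G)"]) auto
  moreover have "ereal (real (card X) / real s) \<in> F" using X ss unfolding F_def s_def by auto
  ultimately have "sun_toughness G \<le> ereal (real (card X) / real s)"
    using False Min_le unfolding sun_toughness_def F_def by auto
  hence "ereal t < ereal (real (card X) / real s)" using t by (rule less_le_trans[rotated])
  hence lt: "t * real s < real (card X)" using X ss by (simp add: field_simps)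
  show ?thesis
  \<comment> \<open>Passing from \<open>sun_count\<close> down to \<open>sun_number\<close>
    preserves the inequality for nonnegative \<open>t\<close>; for negative \<open>t\<close> the
    left side is negative.\<close>
  proof (cases "0 \<le> t")
    case True
    have "t * real (sun_number (adj G) (verts G - X)) \<le> t * real s" using True ss by (intro mult_left_mono) auto
    thus ?thesis using lt by simp
  next
    case False
    hence "t * real (sun_number (adj G) (verts G - X)) < 0" using X(2) by (intro mult_neg_pos) auto
    also have "0 \<le> real (card X)" by simp
    finally show ?thesis .
  qed
qed

text \<open>Deleting a base vertex isolates its pendant, which leaves at most two vertices in
  all.\<close>

lemma (in simple_rel) two_connected_not_sun:
  assumes "finite C" "3 \<le> card C" "\<And>v. v \<in> C \<Longrightarrow> conn_set E (C - {v})" shows "\<not> sun_set E C"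
proof
  assume "sun_set E C"
  moreover have "\<nexists>x. C = {x}" using assms(2) by auto
  ultimately obtain H u where H: "corona E C H u" by (auto simp: sun_set_def)
  have "H \<noteq> {}" using H assms(2) by (auto simp: corona_def)
  then obtain v where v: "v \<in> H" by auto
  have mem: "v \<in> C" "u v \<in> C" "u v \<noteq> v" using corona_mem[OF H v] corona_disj[OF H v v] by auto
  have "{u v} = C - {v}"
  proof (rule conn_setD[OF assms(3)[OF mem(1)]])
    show "no_edge E {u v} (C - {v} - {u v})" using H v unfolding no_edge_def corona_def by blast
  qed (use mem in auto)
  hence "C = {u v, v}" using mem by auto
  hence "card C \<le> 2" using card_insert_le_m1[of 2 "{v}" "u v"] by simp
  thus False using assms(2) by simp
qed

text \<open>If \<open>n\<close> were at least \<open>2 * x + 1\<close>, putting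
  \<open>x = y + 2\<close> and expanding would give \<open>2 * y * l + 2 * l < y + 1\<close>, which
  fails for \<open>l \<ge> 1\<close>.\<close>

lemma sun_bound_arith:
  fixes l x n :: nat
  assumes "1 \<le> l" "2 \<le> x" "n * (l + 1) < 3 * (l + x)" shows "n \<le> 2 * x"
proof (rule ccontr)
  assume "\<not> n \<le> 2 * x"
  hence "(2 * x + 1) * (l + 1) \<le> n * (l + 1)" by (intro mult_right_mono) auto
  hence 1: "(2 * x + 1) * (l + 1) < 3 * (l + x)" using assms(3) by linarith
  obtain y where y: "x = y + 2" using assms(2) by (metis add.commute le_Suc_ex)
  have "y \<le> y * l" using assms(1) by simp
  moreover have "2 * (y * l) + 2 * l < y + 1" using 1 unfolding y by (simp add: algebra_simps)
  ultimately show False using assms(1) by linarith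
qed

theorem theorem4:
  fixes G :: "('a,'b) pre_digraph" and l :: nat
  assumes "graph G"
    and "1 \<le> l"
    and "l + 2 \<le> vertex_connectivity G"
    and "ereal ((real l + 1) / 3) < sun_toughness G"
  shows "path_factor_critical 3 l G"
  unfolding path_factor_critical_def
proof (intro allI impI, elim conjE)
  fix W assume W: "W \<subseteq> verts G" "card W = l"
  interpret graph G by fact
  interpret E: simple_rel "adj G" by (rule simple_rel_adj[OF assms(1)])
  define V where "V = verts G - W"
  note vc = vertex_connectivityD[OF assms(1,3)]
  have finW: "finite W" using finite_subset[OF W(1)] by simp
  have cardV: "3 \<le> card V" using vc(1) W finW by (simp add: V_def card_Diff_subset)
  \<comment> \<open>Together \<open>W\<close> and \<open>X\<close> have at most \<open>l + 1\<close>
    vertices, one less than the connectivity guarantees.\<close>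
  have conn: "conn_set (adj G) (V - X)" if "X \<subseteq> V" "card X \<le> 1" for X
  proof -
    have "card (W \<union> X) < l + 2" using card_Un_le[of W X] W that by simp
    hence "conn_set (adj G) (verts G - (W \<union> X))" using W that by (intro vc(2)) (auto simp: V_def)
    thus ?thesis by (simp add: V_def set_diff_eq conj_assoc)
  qed
  have nsun: "\<not> sun_set (adj G) V"
    by (rule E.two_connected_not_sun) (use cardV conn in \<open>auto simp: V_def\<close>)
  have bound: "sun_number (adj G) (V - X) \<le> 2 * card X" if X: "X \<subseteq> V" for X
  proof -
    have finX: "finite X" using finite_subset[OF X] by (simp add: V_def)
    \<comment> \<open>For \<open>X = {}\<close> the set is connected and not a sun; for one vertex a
      connected set remains, hence at most one sun. Toughness is used from two vertices on.\<close>
    consider "X = {}" | "card X = 1" | "2 \<le> card X" using finX by (cases "card X") force+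
    thus ?thesis
    proof cases
      case 1 thus ?thesis using conn[of "{}"] nsun by (simp add: sun_number_conn)
    next
      case 2 thus ?thesis using conn[OF X] by (simp add: sun_number_conn)
    next
      case 3
      define n where "n = sun_number (adj G) (V - X)"
      have VX: "V - X = verts G - (W \<union> X)" by (auto simp: V_def)
      have "card (W \<union> X) = l + card X"
        using card_Un_disjoint[OF finW finX] W X by (auto simp: V_def)
      show ?thesis
      \<comment> \<open>Toughness speaks only about deletions that leave at least two suns; fewer
        are within the bound anyway.\<close>
      proof (cases "2 \<le> n")
        case True
        have "(real l + 1) / 3 * real n < real (card (W \<union> X))"
          using sun_toughnessD[OF assms(1,4), of "W \<union> X"] True W X unfolding n_def VX by (auto simp: V_def)
        hence "real (n * (l + 1)) < real (3 * (l + card X))"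
          using \<open>card (W \<union> X) = l + card X\<close> by (simp add: field_simps)
        hence "n * (l + 1) < 3 * (l + card X)" by (simp only: of_nat_less_iff)
        thus ?thesis using sun_bound_arith[OF assms(2) 3] by (simp add: n_def)
      next
        case False
        thus ?thesis using 3 by (simp add: n_def)
      qed
    qed
  qed
  have "sun_bounded (adj (del_verts G W)) V"
    unfolding sun_bounded_def
  proof (intro conjI allI impI)
    fix X assume X: "X \<subseteq> V"
    have "sun_number (adj (del_verts G W)) (V - X) = sun_number (adj G) (V - X)"
      by (rule sun_number_cong) (auto simp: V_def adj_del_verts)
    thus "sun_number (adj (del_verts G W)) (V - X) \<le> 2 * card X" using bound[OF X] by simp
  qed (simp add: V_def)
  hence "path_cover (adj (del_verts G W)) (verts (del_verts G W))"
    using kaneko[OF simple_rel_adj[OF graph_del_verts[OF assms(1)]]] by (simp add: V_def)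
  thus "\<exists>F. path_factor 3 F (del_verts G W)"
    by (rule path_factor_if_path_cover[OF graph_del_verts[OF assms(1)]])
qed

end
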